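(* Let $n\ge1$, $p>1$, $1<q<2$, $K>0$ and $0<s<\frac1q$, and let $$\Theta=\{(x,t)\in\mathbb{R}^n\times\mathbb{R}:\ |x|<K(-t)^s\ \text{and}\ -1<t<0\}.$$ Then there exists a barrier $w$ in $\Theta$ at $(0,0)$ for the equation $\partial_t u=\Delta_p^q u$, although $(0,0)$ is not a regular boundary point of $\Theta$ for this equation.
   Context: Equation. Points of $\mathbb{R}^{n+1}$ are written $(x,t)$, and $\nabla$, $\Delta$, $D^2$ act in $x$ only. The equation is (E): $\partial_t u=\Delta_p^q u$, where for $\nabla u\neq 0$, $\Delta_p^q u=|\nabla u|^{q-p}\operatorname{div}(|\nabla u|^{p-2}\nabla u)=F(\nabla u,D^2u)$ with $F(\eta,X)=|\eta|^{q-2}\operatorname{Tr}\big(X+(p-2)\tfrac{\eta\otimes\eta}{|\eta|^2}X\big)$ for $\eta\in\mathbb{R}^n\setminus\{0\}$ and $X$ a symmetric $n\times n$ matrix. Admissible functions. $\mathcal{F}(F)$ is the set of $f\in C^2([0,\infty))$ with $f(0)=f'(0)=f''(0)=0$, $f''(r)>0$ for all $r>0$, and $\lim_{x\to 0,\,x\ne 0}F(\nabla g(x),D^2g(x))=0$ for $g(x)=f(|x|)$. $\Sigma$ is the set of even $\sigma\in C^1(\mathbb{R})$ with $\sigma(0)=\sigma'(0)=0$ and $\sigma(r)>0$ for $r>0$. A function $\varphi\in C^2(\Theta)$ is admissible at $(x_0,t_0)\in\Theta$ if either $\nabla\varphi(x_0,t_0)\ne0$, or there are $\delta>0$, $f\in\mathcal{F}(F)$,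 $\sigma\in\Sigma$ such that $|\varphi(x,t)-\varphi(x_0,t_0)-\partial_t\varphi(x_0,t_0)(t-t_0)|\le f(|x-x_0|)+\sigma(t-t_0)$ for all $(x,t)\in B_\delta(x_0)\times(t_0-\delta,t_0+\delta)$. Viscosity solutions. $u:\Theta\to\mathbb{R}\cup\{\infty\}$ is a viscosity supersolution of (E) in $\Theta$ if (1) $u$ is lower semicontinuous; (2) $u$ is finite in a dense subset of $\Theta$; (3) whenever $\varphi\in C^2(\Theta)$ is admissible at $\xi\in\Theta$ and touches $u$ at $\xi$ from below (i.e. $\varphi(\xi)=u(\xi)$ and $\varphi<u$ in a punctured neighborhood of $\xi$), then $\partial_t\varphi(\xi)-\Delta_p^q\varphi(\xi)\ge0$ if $\nabla\varphi(\xi)\ne0$, and $\partial_t\varphi(\xi)\ge0$ if $\nabla\varphi(\xi)=0$. Perron solutions and regularity. For bounded $f:\partial\Theta\to\mathbb{R}$, $\mathcal{U}_f$ is the class of viscosity supersolutions $u$ of (E) in $\Theta$ that are bounded from below and satisfy $\liminf_{\Theta\ni\eta\to\xi}u(\eta)\ge f(\xi)$ for all $\xi\in\partial\Theta$; the upper Perron solution is $\overline{H}f(\xi)=\inf_{u\in\mathcal{U}_f}u(\xi)$, $\xi\in\Theta$. A point $\xi_0\in\partial\Theta$ is regular (with respect to $\Theta$) if $\lim_{\Theta\ni\xi\to\xi_0}\overline{H}f(\xi)=f(\xi_0)$ for every $f\in C(\partial\Theta)$. Barrier. A function $w:\Theta\to(0,\infty]$ is a barrier in $\Theta$ at $\xi_0\in\partial\Theta$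 if (a) $w$ is a positive viscosity supersolution of (E) in $\Theta$; (b) $\lim_{\Theta\ni\zeta\to\xi_0}w(\zeta)=0$; (c) $\liminf_{\Theta\ni\zeta\to\xi}w(\zeta)>0$ for every $\xi\in\partial\Theta\setminus\{\xi_0\}$. *)

theory Defs
  imports "HOL-Analysis.Analysis"
begin

definition grad :: "(real^'n \<Rightarrow> real) \<Rightarrow> real^'n \<Rightarrow> real^'n" where
  "grad g x = (\<chi> i. frechet_derivative g (at x) (axis i 1))"

definition hess :: "(real^'n \<Rightarrow> real) \<Rightarrow> real^'n \<Rightarrow> real^'n^'n" where
  "hess g x = jacobian (grad g) (at x)"

definition outer :: "real^'n \<Rightarrow> real^'n \<Rightarrow> real^'n^'n" where
  "outer a b = (\<chi> i j. a $ i * b $ j)"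

definition Fpq :: "real \<Rightarrow> real \<Rightarrow> real^'n \<Rightarrow> real^'n^'n \<Rightarrow> real" where
  "Fpq p q \<eta> X = norm \<eta> powr (q - 2) *
     trace (X + ((p - 2) / (norm \<eta>)\<^sup>2) *\<^sub>R (outer \<eta> \<eta> ** X))"

text \<open>Functions on space-time take a pair \<open>(x, t)\<close>; \<open>grad\<close> and \<open>hess\<close> are applied to a time
  slice, so they differentiate in \<open>x\<close> only. The operator \<open>Lpq\<close> is the non-divergence form of
  \<open>\<bar>\<nabla>u\<bar> powr (q - p) * div (\<bar>\<nabla>u\<bar> powr (p - 2) * \<nabla>u)\<close>; it is meaningful only where the
  spatial gradient does not vanish.\<close>

definition grad_x :: "((real^'n) \<times> real \<Rightarrow> real) \<Rightarrow> (real^'n) \<times> real \<Rightarrow> real^'n" where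
  "grad_x \<phi> \<xi> = grad (\<lambda>y. \<phi> (y, snd \<xi>)) (fst \<xi>)"

definition hess_x :: "((real^'n) \<times> real \<Rightarrow> real) \<Rightarrow> (real^'n) \<times> real \<Rightarrow> real^'n^'n" where
  "hess_x \<phi> \<xi> = hess (\<lambda>y. \<phi> (y, snd \<xi>)) (fst \<xi>)"

definition dt :: "((real^'n) \<times> real \<Rightarrow> real) \<Rightarrow> (real^'n) \<times> real \<Rightarrow> real" where
  "dt \<phi> \<xi> = deriv (\<lambda>\<tau>. \<phi> (fst \<xi>, \<tau>)) (snd \<xi>)"

definition Lpq :: "real \<Rightarrow> real \<Rightarrow> ((real^'n) \<times> real \<Rightarrow> real) \<Rightarrow> (real^'n) \<times> real \<Rightarrow> real" where
  "Lpq p q \<phi> \<xi> = Fpq p q (grad_x \<phi> \<xi>) (hess_x \<phi> \<xi>)"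

text \<open>Meant for open \<open>S\<close>: the derivatives are taken in the whole space.\<close>

definition C2_on :: "('a::real_normed_vector \<Rightarrow> real) \<Rightarrow> 'a set \<Rightarrow> bool" where
  "C2_on f S \<longleftrightarrow> (\<exists>(D1 :: 'a \<Rightarrow> 'a \<Rightarrow>\<^sub>L real) (D2 :: 'a \<Rightarrow> 'a \<Rightarrow>\<^sub>L 'a \<Rightarrow>\<^sub>L real).
     (\<forall>x\<in>S. (f has_derivative blinfun_apply (D1 x)) (at x)) \<and>
     (\<forall>x\<in>S. (D1 has_derivative blinfun_apply (D2 x)) (at x)) \<and>
     continuous_on S D2)"

text \<open>The class \<open>\<F>(F)\<close>; derivatives at the endpoint \<open>0\<close> are one-sided. The filter \<open>at 0\<close> excludes
  the point \<open>0\<close> itself. The type argument fixes the dimension of the space on which the radial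
  function \<open>f(\<bar>x\<bar>)\<close> lives.\<close>

definition admissible_f :: "'n::finite itself \<Rightarrow> real \<Rightarrow> real \<Rightarrow> (real \<Rightarrow> real) \<Rightarrow> bool" where
  "admissible_f TYPE('n) p q f \<longleftrightarrow>
     (\<exists>f' f''.
        (\<forall>r\<ge>0. (f has_real_derivative f' r) (at r within {0..})) \<and>
        (\<forall>r\<ge>0. (f' has_real_derivative f'' r) (at r within {0..})) \<and>
        continuous_on {0..} f'' \<and>
        f 0 = 0 \<and> f' 0 = 0 \<and> f'' 0 = 0 \<and> (\<forall>r>0. f'' r > 0)) \<and>
     ((\<lambda>x::real^'n. Fpq p q (grad (\<lambda>y. f (norm y)) x) (hess (\<lambda>y. f (norm y)) x)) \<longlongrightarrow> 0) (at 0)"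

definition admissible_sigma :: "(real \<Rightarrow> real) \<Rightarrow> bool" where
  "admissible_sigma \<sigma> \<longleftrightarrow> \<sigma> C1_differentiable_on UNIV \<and> (\<forall>r. \<sigma> (- r) = \<sigma> r) \<and>
     \<sigma> 0 = 0 \<and> deriv \<sigma> 0 = 0 \<and> (\<forall>r>0. \<sigma> r > 0)"

text \<open>Test functions are only relevant on \<open>\<Theta>\<close>, so the cylinder is required to lie in \<open>\<Theta>\<close>.\<close>

definition admissible_at ::
  "real \<Rightarrow> real \<Rightarrow> ((real^'n) \<times> real) set \<Rightarrow> ((real^'n) \<times> real \<Rightarrow> real) \<Rightarrow> (real^'n) \<times> real \<Rightarrow> bool" where
  "admissible_at p q \<Theta> \<phi> \<xi> \<longleftrightarrow>
     grad_x \<phi> \<xi> \<noteq> 0 \<or>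
     (\<exists>\<delta>>0. \<exists>f \<sigma>. admissible_f TYPE('n) p q f \<and> admissible_sigma \<sigma> \<and>
        ball (fst \<xi>) \<delta> \<times> {snd \<xi> - \<delta><..<snd \<xi> + \<delta>} \<subseteq> \<Theta> \<and>
        (\<forall>x\<in>ball (fst \<xi>) \<delta>. \<forall>t\<in>{snd \<xi> - \<delta><..<snd \<xi> + \<delta>}.
           \<bar>\<phi> (x, t) - \<phi> \<xi> - dt \<phi> \<xi> * (t - snd \<xi>)\<bar> \<le> f (norm (x - fst \<xi>)) + \<sigma> (t - snd \<xi>)))"

definition touches_below ::
  "'a::topological_space set \<Rightarrow> ('a \<Rightarrow> real) \<Rightarrow> ('a \<Rightarrow> ereal) \<Rightarrow> 'a \<Rightarrow> bool" where
  "touches_below \<Theta> \<phi> u \<xi> \<longleftrightarrow>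
     ereal (\<phi> \<xi>) = u \<xi> \<and> (\<forall>\<^sub>F \<eta> in at \<xi> within \<Theta>. ereal (\<phi> \<eta>) < u \<eta>)"

text \<open>Functions on \<open>\<Theta>\<close> are represented by total functions; only their values on \<open>\<Theta>\<close> matter.
  The first condition says that \<open>u\<close> has values in \<open>\<real> \<union> {\<infinity>}\<close>, the second is lower
  semicontinuity.\<close>

definition viscosity_supersolution ::
  "real \<Rightarrow> real \<Rightarrow> ((real^'n) \<times> real) set \<Rightarrow> ((real^'n) \<times> real \<Rightarrow> ereal) \<Rightarrow> bool" where
  "viscosity_supersolution p q \<Theta> u \<longleftrightarrow>
     (\<forall>\<xi>\<in>\<Theta>. u \<xi> \<noteq> - \<infinity>) \<and>
     (\<forall>\<xi>\<in>\<Theta>. u \<xi> \<le> Liminf (at \<xi> within \<Theta>) u) \<and>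
     \<Theta> \<subseteq> closure {\<xi>\<in>\<Theta>. u \<xi> \<noteq> \<infinity>} \<and>
     (\<forall>\<phi>. \<forall>\<xi>\<in>\<Theta>. C2_on \<phi> \<Theta> \<and> admissible_at p q \<Theta> \<phi> \<xi> \<and> touches_below \<Theta> \<phi> u \<xi> \<longrightarrow>
        (if grad_x \<phi> \<xi> \<noteq> 0 then dt \<phi> \<xi> - Lpq p q \<phi> \<xi> \<ge> 0 else dt \<phi> \<xi> \<ge> 0))"

definition upper_class ::
  "real \<Rightarrow> real \<Rightarrow> ((real^'n) \<times> real) set \<Rightarrow> ((real^'n) \<times> real \<Rightarrow> real)
     \<Rightarrow> ((real^'n) \<times> real \<Rightarrow> ereal) set" where
  "upper_class p q \<Theta> f = {u. viscosity_supersolution p q \<Theta> u \<and>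
     (\<exists>c::real. \<forall>\<xi>\<in>\<Theta>. ereal c \<le> u \<xi>) \<and>
     (\<forall>\<xi>\<in>frontier \<Theta>. ereal (f \<xi>) \<le> Liminf (at \<xi> within \<Theta>) u)}"

definition upper_Perron ::
  "real \<Rightarrow> real \<Rightarrow> ((real^'n) \<times> real) set \<Rightarrow> ((real^'n) \<times> real \<Rightarrow> real)
     \<Rightarrow> (real^'n) \<times> real \<Rightarrow> ereal" where
  "upper_Perron p q \<Theta> f \<xi> = (INF u\<in>upper_class p q \<Theta> f. u \<xi>)"

text \<open>Boundary data are continuous, hence bounded when \<open>\<Theta>\<close> is bounded.\<close>

definition regular_boundary_point ::
  "real \<Rightarrow> real \<Rightarrow> ((real^'n) \<times> real) set \<Rightarrow> (real^'n) \<times> real \<Rightarrow> bool" where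
  "regular_boundary_point p q \<Theta> \<xi>\<^sub>0 \<longleftrightarrow> \<xi>\<^sub>0 \<in> frontier \<Theta> \<and>
     (\<forall>f. continuous_on (frontier \<Theta>) f \<longrightarrow>
        (upper_Perron p q \<Theta> f \<longlongrightarrow> ereal (f \<xi>\<^sub>0)) (at \<xi>\<^sub>0 within \<Theta>))"

definition barrier ::
  "real \<Rightarrow> real \<Rightarrow> ((real^'n) \<times> real) set \<Rightarrow> (real^'n) \<times> real
     \<Rightarrow> ((real^'n) \<times> real \<Rightarrow> ereal) \<Rightarrow> bool" where
  "barrier p q \<Theta> \<xi>\<^sub>0 w \<longleftrightarrow> \<xi>\<^sub>0 \<in> frontier \<Theta> \<and>
     (\<forall>\<zeta>\<in>\<Theta>. w \<zeta> > 0) \<and> viscosity_supersolution p q \<Theta> w \<and>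
     (w \<longlongrightarrow> 0) (at \<xi>\<^sub>0 within \<Theta>) \<and>
     (\<forall>\<xi>\<in>frontier \<Theta> - {\<xi>\<^sub>0}. Liminf (at \<xi> within \<Theta>) w > 0)"

end

theory Submission
  imports Defs
begin

text \<open>Write \<open>\<tau> = - t\<close>. For the barrier take \<open>w = A * \<tau> powr \<alpha> - B * \<tau> powr \<gamma> * \<bar>x\<bar>\<^sup>2\<close> with \<open>\<alpha> = \<gamma> + 2 * s\<close>.
  The operator has homogeneity \<open>q - 1 < 1\<close>, so that for large \<open>\<gamma>\<close> and small \<open>B\<close> diffusion dominates the decay in
  time off the axis. On the axis no admissible function touches \<open>w\<close> from below, since admissible functions are
  \<open>o(\<bar>x\<bar>\<^sup>2)\<close> there.

  The vertex is not regular because, for \<open>2 * k > q / (q - 1)\<close>,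
  \<open>v = K ^ (2 * k) + C * \<tau> powr (1 - s * q) - \<bar>x\<bar> ^ (2 * k) / \<tau> powr (2 * k * s)\<close>
  is a classical subsolution for suitable \<open>C\<close> that lies below the boundary data
  \<open>(K ^ (2 * k) + C) * \<tau> powr (1 - s * q)\<close>, which vanish at the vertex, while \<open>v \<ge> K ^ (2 * k)\<close> on the axis.
  Each supersolution in the upper class lies above \<open>v\<close>: minimise \<open>u - v + \<epsilon> / \<tau>\<close>, where the last
  term makes the inequality strict and removes the vertex from consideration. The lower bound on \<open>k\<close> makes the
  test functions admissible on the axis.\<close>

subsection \<open>Twice continuously differentiable functions and the operator\<close>

lemma C2_on_bounded_linear:
  assumes "bounded_linear l"
  shows "C2_on l S"
proof -
  have "(l has_derivative blinfun_apply (Blinfun l)) (at x)" for x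
    using assms by (simp add: bounded_linear_Blinfun_apply bounded_linear_imp_has_derivative)
  moreover have "((\<lambda>x. Blinfun l) has_derivative blinfun_apply 0) (at x)" for x :: 'a
    by (simp add: zero_blinfun.rep_eq[abs_def])
  ultimately show ?thesis
    unfolding C2_on_def
    by (intro exI[of _ "\<lambda>x. Blinfun l"] exI[of _ "\<lambda>x. 0"]) auto
qed

lemma C2_on_const: "C2_on (\<lambda>x. c) S"
  unfolding C2_on_def
  by (intro exI[of _ "\<lambda>x. 0"]) (auto simp: zero_blinfun.rep_eq[abs_def])

lemma C2_on_add:
  assumes "C2_on f S" "C2_on g S"
  shows "C2_on (\<lambda>x. f x + g x) S"
proof -
  obtain F1 F2 where F: "\<forall>x\<in>S. (f has_derivative blinfun_apply (F1 x)) (at x)"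
     "\<forall>x\<in>S. (F1 has_derivative blinfun_apply (F2 x)) (at x)" "continuous_on S F2"
    using assms(1) unfolding C2_on_def by blast
  obtain G1 G2 where G: "\<forall>x\<in>S. (g has_derivative blinfun_apply (G1 x)) (at x)"
     "\<forall>x\<in>S. (G1 has_derivative blinfun_apply (G2 x)) (at x)" "continuous_on S G2"
    using assms(2) unfolding C2_on_def by blast
  show ?thesis
    unfolding C2_on_def
    by (intro exI[of _ "\<lambda>x. F1 x + G1 x"] exI[of _ "\<lambda>x. F2 x + G2 x"])
       (use F G in \<open>auto intro!: has_derivative_add continuous_on_add simp: plus_blinfun.rep_eq[abs_def]\<close>)
qed

text \<open>The set \<open>T\<close> admits outer functions that are smooth on part of the line
  only, such as real powers on the positive half-line.\<close>

lemma C2_on_compose: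
  fixes h h' h'' :: "real \<Rightarrow> real"
  assumes "C2_on f S" and fS: "\<And>x. x \<in> S \<Longrightarrow> f x \<in> T"
    and h: "\<And>y. y \<in> T \<Longrightarrow> (h has_real_derivative h' y) (at y)"
    and h': "\<And>y. y \<in> T \<Longrightarrow> (h' has_real_derivative h'' y) (at y)"
    and h'': "continuous_on T h''"
  shows "C2_on (\<lambda>x. h (f x)) S"
proof -
  obtain F1 F2 where F: "\<And>x. x\<in>S \<Longrightarrow> (f has_derivative blinfun_apply (F1 x)) (at x)"
     "\<And>x. x\<in>S \<Longrightarrow> (F1 has_derivative blinfun_apply (F2 x)) (at x)" "continuous_on S F2"
    using assms(1) unfolding C2_on_def by blast
  define D1 where "D1 x = h' (f x) *\<^sub>R F1 x" for x
  \<comment> \<open>The second summand is the rank-one form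
    \<open>h'' (f x) * F1 x v * F1 x w\<close> in the arguments \<open>v\<close> and
    \<open>w\<close>, as in the chain rule for second derivatives.\<close>
  define D2 where "D2 x = h' (f x) *\<^sub>R F2 x + h'' (f x) *\<^sub>R (blinfun_scaleR_left (F1 x) o\<^sub>L F1 x)" for x
  have cf: "continuous_on S f" "continuous_on S F1"
    using F(1,2) by (meson continuous_at_imp_continuous_on has_derivative_continuous)+
  have ch': "continuous_on T h'"
    using h' by (meson continuous_at_imp_continuous_on DERIV_continuous)
  have 1: "((\<lambda>x. h (f x)) has_derivative blinfun_apply (D1 x)) (at x)" if "x \<in> S" for x
  proof -
    have "((\<lambda>x. h (f x)) has_derivative (\<lambda>v. h' (f x) * F1 x v)) (at x)"
      using has_derivative_compose[OF F(1)[OF that] h[OF fS[OF that], unfolded has_field_derivative_def]] .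
    then show ?thesis by (simp add: D1_def scaleR_blinfun.rep_eq[abs_def])
  qed
  have 2: "(D1 has_derivative blinfun_apply (D2 x)) (at x)" if "x \<in> S" for x
  proof -
    have "((\<lambda>x. h' (f x)) has_derivative (\<lambda>v. h'' (f x) * F1 x v)) (at x)"
      using has_derivative_compose[OF F(1)[OF that] h'[OF fS[OF that], unfolded has_field_derivative_def]] .
    from has_derivative_scaleR[OF this F(2)[OF that]]
    have "(D1 has_derivative (\<lambda>v. h' (f x) *\<^sub>R F2 x v + (h'' (f x) * F1 x v) *\<^sub>R F1 x)) (at x)"
      by (simp add: D1_def[abs_def])
    moreover have "(\<lambda>v. h' (f x) *\<^sub>R F2 x v + (h'' (f x) * F1 x v) *\<^sub>R F1 x) = blinfun_apply (D2 x)"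
      by (auto simp: D2_def plus_blinfun.rep_eq scaleR_blinfun.rep_eq fun_eq_iff)
    ultimately show ?thesis by simp
  qed
  have "continuous_on S D2"
    unfolding D2_def using F(3) cf ch' h'' fS
    by (auto intro!: continuous_intros continuous_on_compose2[of T h' S f] continuous_on_compose2[of T h'' S f]
      bounded_bilinear.continuous_on[OF bounded_bilinear_blinfun_compose]
      bounded_linear.continuous_on[OF bounded_linear_blinfun_scaleR_left])
  with 1 2 show ?thesis unfolding C2_on_def by blast
qed

lemma C2_on_cmult:
  assumes "C2_on f S"
  shows "C2_on (\<lambda>x. c * f x :: real) S"
  by (rule C2_on_compose[OF assms, of UNIV _ "\<lambda>_. c" "\<lambda>_. 0"]) (auto intro!: derivative_eq_intros)

lemma C2_on_minus:
  assumes "C2_on f S" "C2_on g S"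
  shows "C2_on (\<lambda>x. f x - g x) S"
  using C2_on_add[OF assms(1) C2_on_cmult[OF assms(2), of "-1"]] by simp

lemma C2_on_power:
  fixes f :: "'a::real_normed_vector \<Rightarrow> real"
  assumes "C2_on f S"
  shows "C2_on (\<lambda>x. f x ^ k) S"
  by (rule C2_on_compose[OF assms, of UNIV _ "\<lambda>y. real k * y ^ (k - 1)" "\<lambda>y. real k * (real (k - 1) * y ^ (k - 1 - 1))"])
     (auto intro!: derivative_eq_intros continuous_intros)

text \<open>Polarization reduces products to squares and thus to composition with a real function.\<close>

lemma C2_on_mult:
  fixes f g :: "'a::real_normed_vector \<Rightarrow> real"
  assumes "C2_on f S" "C2_on g S"
  shows "C2_on (\<lambda>x. f x * g x) S"
proof -
  have "C2_on (\<lambda>x. (1/4) * ((f x + g x)^2 - (f x - g x)^2)) S"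
    by (intro C2_on_cmult C2_on_minus C2_on_power C2_on_add assms)
  then show ?thesis by (simp add: power2_eq_square algebra_simps)
qed

lemma C2_on_sum:
  assumes "\<And>i. i \<in> I \<Longrightarrow> C2_on (f i) S"
  shows "C2_on (\<lambda>x. \<Sum>i\<in>I. f i x) S"
  using assms by (induction I rule: infinite_finite_induct) (auto intro!: C2_on_add C2_on_const)

lemma C2_on_powr:
  assumes "C2_on f S" and "\<And>x. x \<in> S \<Longrightarrow> f x > 0"
  shows "C2_on (\<lambda>x. f x powr e) S"
proof (rule C2_on_compose[OF assms(1), of "{0<..}" _ "\<lambda>y. e * y powr (e - 1)" "\<lambda>y. e * ((e - 1) * y powr (e - 1 - 1))"])
  show "((\<lambda>y. e * y powr (e - 1)) has_real_derivative e * ((e - 1) * y powr (e - 1 - 1))) (at y)"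
    if "y \<in> {0<..}" for y
    using that by (intro DERIV_cmult has_real_derivative_powr) auto
qed (use assms(2) in \<open>auto intro!: continuous_intros has_real_derivative_powr\<close>)

lemma C2_on_inner_fst:
  "C2_on (\<lambda>z. (fst z - a) \<bullet> (fst z - a)) (S :: ((real^'n) \<times> real) set)"
proof -
  have "bounded_linear (\<lambda>z::(real^'n) \<times> real. fst z $ i)" for i
    using bounded_linear_compose[OF bounded_linear_vec_nth bounded_linear_fst] .
  then have "C2_on (\<lambda>z. \<Sum>i\<in>UNIV. (fst z $ i - a $ i)^2) S"
    by (intro C2_on_sum C2_on_power C2_on_minus C2_on_const C2_on_bounded_linear)
  then show ?thesis by (simp add: inner_vec_def power2_eq_square)
qed

section \<open>Gradient, Hessian and operator expressed through derivatives\<close>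

lemma grad_eqI:
  fixes g :: "real^'n \<Rightarrow> real"
  assumes "(g has_derivative (\<lambda>h. v \<bullet> h)) (at x)"
  shows "grad g x = v"
  unfolding grad_def frechet_derivative_at[OF assms, symmetric]
  by (simp add: vec_eq_iff inner_axis)

text \<open>\<open>hess\<close> differentiates \<open>grad g\<close>, so the gradient has to be
  known near \<open>x\<close> and not only at \<open>x\<close>; \<open>U\<close> is the
  neighbourhood on which \<open>G\<close> represents it.\<close>

lemma hess_eqI:
  fixes g :: "real^'n \<Rightarrow> real"
  assumes "open U" "x \<in> U" and "\<And>y. y \<in> U \<Longrightarrow> (g has_derivative (\<lambda>h. G y \<bullet> h)) (at y)"
    and "(G has_derivative L) (at x)"
  shows "hess g x = matrix L"
proof -
  have "(grad g has_derivative L) (at x)"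
    by (rule has_derivative_transform_within_open[OF assms(4,1,2)]) (simp add: grad_eqI[OF assms(3)])
  from frechet_derivative_at[OF this] show ?thesis
    by (simp add: hess_def jacobian_def)
qed

text \<open>The trace of \<open>outer \<eta> \<eta> ** matrix L\<close> is the quadratic form of
  \<open>L\<close> at \<open>\<eta>\<close>. The operator thus becomes a trace plus a normalised
  second derivative in the direction \<open>\<eta>\<close>, which can be computed on linear
  maps.\<close>

lemma Fpq_matrix:
  fixes L :: "real^'n \<Rightarrow> real^'n"
  assumes "linear L"
  shows "Fpq p q \<eta> (matrix L) = norm \<eta> powr (q - 2) *
     ((\<Sum>i\<in>UNIV. L (axis i 1) $ i) + (p - 2) * (\<eta> \<bullet> L \<eta>) / (norm \<eta>)\<^sup>2)"
proof -
  have L: "L \<eta> = matrix L *v \<eta>" using matrix_vector_mul(2)[OF assms] by simp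
  have "\<eta> \<bullet> L \<eta> = trace (outer \<eta> \<eta> ** matrix L)"
    unfolding L inner_vec_def trace_def matrix_matrix_mult_def matrix_vector_mult_def outer_def
    by (simp add: sum_distrib_left sum_distrib_right mult_ac, subst sum.swap, simp add: mult_ac)
  moreover have "trace (c *\<^sub>R A) = c * trace A" for c and A :: "real^'n^'n"
    by (simp add: trace_def sum_distrib_left)
  moreover have "trace (matrix L) = (\<Sum>i\<in>UNIV. L (axis i 1) $ i)"
    by (simp add: trace_def matrix_def)
  ultimately show ?thesis
    by (simp add: Fpq_def trace_add)
qed

subsection \<open>Touching by a paraboloid\<close>

text \<open>If \<open>c\<close> were positive, \<open>\<psi>'\<close> would be positive just to the
  right of its zero at 0, and the mean value theorem would give a value above the maximum.\<close>

lemma second_derivative_test_max: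
  fixes \<psi> \<psi>' :: "real \<Rightarrow> real"
  assumes max: "\<forall>\<^sub>F s in nhds 0. \<psi> s \<le> \<psi> 0"
    and der: "\<forall>\<^sub>F s in nhds 0. (\<psi> has_real_derivative \<psi>' s) (at s)"
    and der': "(\<psi>' has_real_derivative c) (at 0)"
  shows "\<psi>' 0 = 0" and "c \<le> 0"
proof -
  obtain d where d: "d > 0" "\<And>s. \<bar>s\<bar> < d \<Longrightarrow> \<psi> s \<le> \<psi> 0"
    "\<And>s. \<bar>s\<bar> < d \<Longrightarrow> (\<psi> has_real_derivative \<psi>' s) (at s)"
    using eventually_conj[OF max der] unfolding eventually_nhds_metric by (auto simp: dist_real_def)
  show z: "\<psi>' 0 = 0"
    using DERIV_local_max[OF d(3)[of 0] d(1)] d(1,2) by auto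
  show "c \<le> 0"
  proof (rule ccontr)
    assume "\<not> c \<le> 0"
    then obtain e where e: "e > 0" "\<And>h. 0 < h \<Longrightarrow> h < e \<Longrightarrow> \<psi>' h > 0"
      using DERIV_pos_inc_right[OF der'] z by auto
    define h where "h = min d e / 2"
    have h: "0 < h" "h < d" "h < e" using d(1) e(1) by (auto simp: h_def)
    have "\<exists>y. 0 < y \<and> y < h \<and> \<psi> h - \<psi> 0 = (h - 0) * \<psi>' y"
      by (rule MVT2) (use h d in auto)
    then obtain y where "0 < y" "y < h" "\<psi> h - \<psi> 0 = h * \<psi>' y" by auto
    with e(2)[of y] h d(2)[of h] show False
      by (smt (verit) mult_pos_pos)
  qed
qed

text \<open>The difference of \<open>\<phi>\<close> and the paraboloid has a local maximum at
  \<open>(x, t)\<close>. The first-order conditions determine the gradient and the time derivative,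
  the second-order condition in space bounds the Hessian from above.\<close>

lemma touching_paraboloid:
  fixes \<phi> :: "(real^'n) \<times> real \<Rightarrow> real"
  assumes "open \<Theta>" "(x, t) \<in> \<Theta>" "C2_on \<phi> \<Theta>"
    and a: "(a has_real_derivative a') (at t)" and b: "(b has_real_derivative b') (at t)"
    and eq: "\<phi> (x, t) = a t - b t * (x \<bullet> x)"
    and le: "\<forall>\<^sub>F \<eta> in nhds (x, t). \<phi> \<eta> \<le> a (snd \<eta>) - b (snd \<eta>) * (fst \<eta> \<bullet> fst \<eta>)"
  shows "grad_x \<phi> (x, t) = (- 2 * b t) *\<^sub>R x"
    and "dt \<phi> (x, t) = a' - b' * (x \<bullet> x)"
    and "\<exists>L. linear L \<and> hess_x \<phi> (x, t) = matrix L \<and> (\<forall>z. z \<bullet> L z \<le> - 2 * b t * (z \<bullet> z))"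
proof -
  obtain D1 D2 where D: "\<And>\<xi>. \<xi>\<in>\<Theta> \<Longrightarrow> (\<phi> has_derivative blinfun_apply (D1 \<xi>)) (at \<xi>)"
     "\<And>\<xi>. \<xi>\<in>\<Theta> \<Longrightarrow> (D1 has_derivative blinfun_apply (D2 \<xi>)) (at \<xi>)"
    using assms(3) unfolding C2_on_def by blast
  have nh: "\<forall>\<^sub>F s in nhds 0. P (c s)" if "isCont c 0" "c 0 = (x, t)" "\<forall>\<^sub>F \<eta> in nhds (x, t). P \<eta>"
    for c :: "real \<Rightarrow> _" and P
    using that unfolding isCont_def tendsto_at_iff_tendsto_nhds by (metis eventually_compose_filterlim)
  have in\<Theta>: "\<forall>\<^sub>F \<eta> in nhds (x, t). \<eta> \<in> \<Theta>"
    using assms(1,2) by (simp add: eventually_nhds_in_open)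
  \<comment> \<open>On the spatial line through \<open>x\<close> in the direction \<open>z\<close>,
    the second derivative test yields the gradient identity from \<open>\<psi>' 0 = 0\<close> and
    the Hessian bound from the sign of the second derivative.\<close>
  have line: "D1 (x, t) (z, 0) = - 2 * b t * (x \<bullet> z) \<and> D2 (x, t) (z, 0) (z, 0) + 2 * b t * (z \<bullet> z) \<le> 0" for z
  proof -
    define c where "c s = (x + s *\<^sub>R z, t)" for s
    have c: "isCont c 0" "c 0 = (x, t)" unfolding c_def by (auto intro!: continuous_intros)
    define \<psi> where "\<psi> s = \<phi> (c s) - (a t - b t * ((x + s *\<^sub>R z) \<bullet> (x + s *\<^sub>R z)))" for s
    define \<psi>' where "\<psi>' s = D1 (c s) (z, 0) + 2 * b t * ((x + s *\<^sub>R z) \<bullet> z)" for s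
    have cd: "(c has_derivative (\<lambda>h. h *\<^sub>R (z, 0))) (at s)" for s
      unfolding c_def by (auto intro!: derivative_eq_intros)
    have 1: "\<forall>\<^sub>F s in nhds 0. \<psi> s \<le> \<psi> 0"
      using nh[OF c le] by eventually_elim (use eq in \<open>simp add: \<psi>_def c_def\<close>)
    have 2: "\<forall>\<^sub>F s in nhds 0. (\<psi> has_real_derivative \<psi>' s) (at s)"
      using nh[OF c in\<Theta>]
    proof eventually_elim
      case (elim s)
      have "((\<lambda>s. \<phi> (c s)) has_derivative (\<lambda>h. D1 (c s) (h *\<^sub>R (z, 0)))) (at s)"
        using has_derivative_compose[OF cd D(1)[OF elim]] .
      then have "((\<lambda>s. \<phi> (c s)) has_real_derivative D1 (c s) (z, 0)) (at s)"
        unfolding has_field_derivative_def blinfun.scaleR_right by (simp add: mult_commute_abs)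
      moreover have "((\<lambda>s. (x + s *\<^sub>R z) \<bullet> (x + s *\<^sub>R z)) has_real_derivative 2 * ((x + s *\<^sub>R z) \<bullet> z)) (at s)"
        unfolding has_field_derivative_def
        by (auto intro!: derivative_eq_intros simp: algebra_simps inner_commute)
      ultimately show ?case unfolding \<psi>_def \<psi>'_def
        by (auto intro!: derivative_eq_intros)
    qed
    have 3: "(\<psi>' has_real_derivative D2 (x, t) (z, 0) (z, 0) + 2 * b t * (z \<bullet> z)) (at 0)"
    proof -
      have "((\<lambda>s. D1 (c s)) has_derivative (\<lambda>h. D2 (x, t) (h *\<^sub>R (z, 0)))) (at 0)"
        by (rule has_derivative_compose[OF cd]) (use D(2)[OF assms(2)] c(2) in simp)
      then have "((\<lambda>s. D1 (c s) (z, 0)) has_derivative (\<lambda>h. D2 (x, t) (h *\<^sub>R (z, 0)) (z, 0))) (at 0)"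
        by (rule bounded_linear.has_derivative[OF blinfun.bounded_linear_left])
      then have "((\<lambda>s. D1 (c s) (z, 0)) has_real_derivative D2 (x, t) (z, 0) (z, 0)) (at 0)"
        unfolding has_field_derivative_def blinfun.scaleR_right blinfun.scaleR_left by (simp add: mult_commute_abs)
      moreover have "((\<lambda>s. (x + s *\<^sub>R z) \<bullet> z) has_real_derivative z \<bullet> z) (at 0)"
        unfolding has_field_derivative_def
        by (auto intro!: derivative_eq_intros simp: algebra_simps inner_commute)
      ultimately show ?thesis unfolding \<psi>'_def
        by (auto intro!: derivative_eq_intros)
    qed
    show ?thesis
      using second_derivative_test_max[OF 1 2 3] c(2) by (simp add: \<psi>'_def)
  qed
  have emb: "((\<lambda>y. (y, t)) has_derivative (\<lambda>h. (h, 0))) (at y)" for y :: "real^'n"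
    by (auto intro!: derivative_eq_intros)
  have slice: "((\<lambda>y. \<phi> (y, t)) has_derivative (\<lambda>h. D1 (y, t) (h, 0))) (at y)" if "(y, t) \<in> \<Theta>" for y
    using has_derivative_compose[OF emb D(1)[OF that]] .
  have "((\<lambda>y. \<phi> (y, t)) has_derivative (\<lambda>h. ((- 2 * b t) *\<^sub>R x) \<bullet> h)) (at x)"
    using slice[OF assms(2)] line by simp
  then show "grad_x \<phi> (x, t) = (- 2 * b t) *\<^sub>R x"
    unfolding grad_x_def by (simp add: grad_eqI)
  show "dt \<phi> (x, t) = a' - b' * (x \<bullet> x)"
  proof -
    have "((\<lambda>\<tau>. (x, \<tau>)) has_derivative (\<lambda>h. (0, h))) (at t)"
      by (auto intro!: derivative_eq_intros)
    from has_derivative_compose[OF this D(1)[OF assms(2)]]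
    have "((\<lambda>\<tau>. \<phi> (x, \<tau>)) has_derivative (\<lambda>h. D1 (x, t) (h *\<^sub>R (0, 1)))) (at t)" by simp
    then have d: "((\<lambda>\<tau>. \<phi> (x, \<tau>)) has_real_derivative D1 (x, t) (0, 1)) (at t)"
      unfolding has_field_derivative_def blinfun.scaleR_right by (simp add: mult_commute_abs)
    have d2: "((\<lambda>\<tau>. \<phi> (x, \<tau>) - (a \<tau> - b \<tau> * (x \<bullet> x))) has_real_derivative
        D1 (x, t) (0, 1) - (a' - b' * (x \<bullet> x))) (at t)"
      by (intro DERIV_diff DERIV_cmult_right d a b)
    have "filterlim (\<lambda>\<tau>. (x, \<tau>)) (nhds (x, t)) (nhds t)"
      by (intro tendsto_Pair tendsto_const filterlim_ident)
    then have "\<forall>\<^sub>F \<tau> in nhds t. \<phi> (x, \<tau>) - (a \<tau> - b \<tau> * (x \<bullet> x)) \<le> 0"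
      using eventually_compose_filterlim[OF le] by force
    then obtain d where "d > 0" "\<And>\<tau>. \<bar>t - \<tau>\<bar> < d \<Longrightarrow> \<phi> (x, \<tau>) - (a \<tau> - b \<tau> * (x \<bullet> x)) \<le> 0"
      unfolding eventually_nhds_metric by (auto simp: dist_real_def abs_minus_commute)
    with DERIV_local_max[OF d2, of d] eq
    have "D1 (x, t) (0, 1) = a' - b' * (x \<bullet> x)" by auto
    then show ?thesis unfolding dt_def using DERIV_imp_deriv[OF d] by simp
  qed
  define U where "U = (\<lambda>y. (y, t)) -` \<Theta>"
  have U: "open U" "x \<in> U"
    unfolding U_def using assms(1,2) by (auto intro!: open_vimage continuous_intros)
  \<comment> \<open>\<open>G y\<close> is the vector that represents the spatial part of the
    functional \<open>D1 (y, t)\<close>, and \<open>L\<close> is the derivative of \<open>G\<close>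
    at \<open>x\<close>; \<open>rep\<close> below recovers a functional from its representing
    vector.\<close>
  define G where "G y = (\<Sum>e\<in>Basis. D1 (y, t) (e, 0) *\<^sub>R e)" for y :: "real^'n"
  define L where "L h = (\<Sum>e\<in>Basis. D2 (x, t) (h, 0) (e, 0) *\<^sub>R e)" for h :: "real^'n"
  have rep: "(\<Sum>e\<in>Basis. blinfun_apply A (e, 0) *\<^sub>R e) \<bullet> h = blinfun_apply A (h, 0)"
    for A :: "((real^'n) \<times> real) \<Rightarrow>\<^sub>L real" and h
  proof -
    have lin: "linear (\<lambda>h. blinfun_apply A (h, 0))"
    proof (rule linearI)
      show "blinfun_apply A (x + y, 0) = blinfun_apply A (x, 0) + blinfun_apply A (y, 0)" for x y
        using blinfun.add_right[of A "(x, 0)" "(y, 0)"] by simp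
      show "blinfun_apply A (r *\<^sub>R x, 0) = r *\<^sub>R blinfun_apply A (x, 0)" for r x
        using blinfun.scaleR_right[of A r "(x, 0)"] by simp
    qed
    have "blinfun_apply A (\<Sum>e\<in>Basis. (h \<bullet> e) *\<^sub>R e, 0) = (\<Sum>e\<in>Basis. (h \<bullet> e) * blinfun_apply A (e, 0))"
      by (simp add: linear_sum[OF lin] linear_cmul[OF lin])
    then show ?thesis
      unfolding euclidean_representation by (simp add: inner_sum_right inner_commute mult.commute)
  qed
  have "((\<lambda>y. D1 (y, t)) has_derivative (\<lambda>h. D2 (x, t) (h, 0))) (at x)"
    using has_derivative_compose[OF emb D(2)[OF assms(2)]] .
  then have "((\<lambda>y. D1 (y, t) (e, 0)) has_derivative (\<lambda>h. D2 (x, t) (h, 0) (e, 0))) (at x)" for e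
    by (rule bounded_linear.has_derivative[OF blinfun.bounded_linear_left])
  then have GL: "(G has_derivative L) (at x)"
    unfolding G_def L_def by (intro has_derivative_sum has_derivative_scaleR_left)
  have "hess (\<lambda>y. \<phi> (y, t)) x = matrix L"
    by (rule hess_eqI[OF U _ GL]) (use slice in \<open>simp add: U_def G_def rep\<close>)
  moreover have "z \<bullet> L z \<le> - 2 * b t * (z \<bullet> z)" for z
    using line[of z] rep[of "D2 (x, t) (z, 0)" z] by (simp add: L_def inner_commute)
  moreover have "linear L" using GL by (rule has_derivative_linear)
  ultimately show "\<exists>L. linear L \<and> hess_x \<phi> (x, t) = matrix L \<and> (\<forall>z. z \<bullet> L z \<le> - 2 * b t * (z \<bullet> z))"
    unfolding hess_x_def by auto
qed

text \<open>Up to the factor \<open>norm \<eta> powr (q - 2)\<close>, the operator is the trace of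
  \<open>L\<close> on the complement of \<open>\<eta>\<close> plus \<open>p - 1\<close> times the
  second derivative along \<open>\<eta>\<close>. The two parts are at most \<open>- \<mu>\<close>
  times \<open>n - 1\<close> and \<open>p - 1\<close>, where \<open>n\<close> is the dimension;
  \<open>p \<ge> 1\<close> gives the second weight the right sign.\<close>

lemma Fpq_le:
  fixes L :: "real^'n \<Rightarrow> real^'n"
  assumes "linear L" and neg: "\<And>z. z \<bullet> L z \<le> - \<mu> * (z \<bullet> z)" and "\<eta> \<noteq> 0" and "p \<ge> 1"
  shows "Fpq p q \<eta> (matrix L) \<le> - \<mu> * norm \<eta> powr (q - 2) * (real CARD('n) + p - 2)"
proof -
  define e where "e = \<eta> /\<^sub>R norm \<eta>"
  have ee: "e \<bullet> e = 1" using assms(3) by (simp add: e_def flip: power2_norm_eq_inner)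
  have ax: "axis i 1 \<bullet> v = v $ i" "v \<bullet> axis i 1 = v $ i" for i and v :: "real^'n"
    by (simp_all add: inner_axis inner_axis')
  \<comment> \<open>\<open>P i\<close> is the projection of the \<open>i\<close>-th coordinate
    vector to the complement of the unit vector \<open>e\<close>. Summing
    \<open>P i \<bullet> L (P i)\<close> gives the trace of \<open>L\<close> on that complement,
    that is, the full trace minus \<open>e \<bullet> L e\<close>.\<close>
  define P where "P i = axis i 1 - (e $ i) *\<^sub>R e" for i
  have "(\<Sum>i\<in>UNIV. P i \<bullet> L (P i)) \<le> (\<Sum>i\<in>UNIV. - \<mu> * (P i \<bullet> P i))"
    by (intro sum_mono neg)
  have sq: "(\<Sum>i\<in>UNIV. e $ i * e $ i) = 1" using ee by (simp add: inner_vec_def)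
  have "(\<Sum>i\<in>UNIV. P i \<bullet> P i) = (\<Sum>i\<in>UNIV. 1 - e $ i * e $ i)"
    by (simp add: P_def inner_diff_left inner_diff_right ax ee)
  then have PP: "(\<Sum>i\<in>UNIV. P i \<bullet> P i) = real CARD('n) - 1" by (simp add: sum_subtractf sq)
  have Le: "L e = (\<Sum>i\<in>UNIV. e $ i *\<^sub>R L (axis i 1))"
  proof -
    have "L e = L (\<Sum>i\<in>UNIV. e $ i *\<^sub>R axis i 1)"
      by (simp add: basis_expansion flip: scalar_mult_eq_scaleR)
    then show ?thesis by (simp add: linear_sum[OF assms(1)] linear_cmul[OF assms(1)])
  qed
  have "(\<Sum>i\<in>UNIV. P i \<bullet> L (P i)) = (\<Sum>i\<in>UNIV. L (axis i 1) $ i - e $ i * L e $ i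
      - e $ i * (e \<bullet> L (axis i 1)) + (e $ i * e $ i) * (e \<bullet> L e))"
    by (intro sum.cong refl)
       (simp add: P_def linear_diff[OF assms(1)] linear_cmul[OF assms(1)] inner_diff_left inner_diff_right ax algebra_simps)
  also have "\<dots> = (\<Sum>i\<in>UNIV. L (axis i 1) $ i) - e \<bullet> L e - e \<bullet> L e + e \<bullet> L e"
  proof -
    have "(\<Sum>i\<in>UNIV. e $ i * (e \<bullet> L (axis i 1))) = e \<bullet> L e"
      by (subst Le) (simp add: inner_sum_right)
    moreover have "(\<Sum>i\<in>UNIV. e $ i * L e $ i) = e \<bullet> L e" by (simp add: inner_vec_def)
    ultimately show ?thesis by (simp add: sum.distrib sum_subtractf sq flip: sum_distrib_right)
  qed
  finally have "(\<Sum>i\<in>UNIV. L (axis i 1) $ i) - e \<bullet> L e \<le> - \<mu> * (real CARD('n) - 1)"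
    using \<open>(\<Sum>i\<in>UNIV. P i \<bullet> L (P i)) \<le> _\<close> unfolding PP[symmetric] sum_distrib_left by linarith
  moreover have "(p - 1) * (e \<bullet> L e) \<le> (p - 1) * - \<mu>"
    using neg[of e] ee assms(4) by (intro mult_left_mono) auto
  moreover have "(p - 2) * (\<eta> \<bullet> L \<eta>) / (norm \<eta>)\<^sup>2 = (p - 2) * (e \<bullet> L e)"
    using assms(3) by (simp add: e_def linear_cmul[OF assms(1)] power2_eq_square divide_simps)
  ultimately have "(\<Sum>i\<in>UNIV. L (axis i 1) $ i) + (p - 2) * (\<eta> \<bullet> L \<eta>) / (norm \<eta>)\<^sup>2
      \<le> - \<mu> * (real CARD('n) + p - 2)"
    by (simp add: algebra_simps)
  then show ?thesis
    unfolding Fpq_matrix[OF assms(1)] 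
    using mult_left_mono[of _ _ "norm \<eta> powr (q - 2)"] by (fastforce simp: mult_ac)
qed

subsection \<open>Radial powers\<close>

lemma has_derivative_inner_power:
  fixes a y :: "'a::real_inner"
  shows "((\<lambda>y. ((y - a) \<bullet> (y - a)) ^ k) has_derivative
    (\<lambda>h. ((2 * real k * ((y - a) \<bullet> (y - a)) ^ (k - 1)) *\<^sub>R (y - a)) \<bullet> h)) (at y)"
  by (auto intro!: derivative_eq_intros simp: inner_commute algebra_simps)

text \<open>Time slices of the test functions have this form. As \<open>k \<ge> 2\<close>, the term
  centred at \<open>a\<close> has zero gradient and Hessian at \<open>a\<close>, so it can make a
  touching strict without entering the equation. The choice \<open>c = 0\<close>,
  \<open>\<kappa> = - M\<close>, \<open>\<mu> = 0\<close> covers the pure powers used for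
  admissibility.\<close>

locale radial_profile =
  fixes g :: "real^'n \<Rightarrow> real" and c \<kappa> \<mu> :: real and a :: "real^'n" and k :: nat
  assumes g_def: "g = (\<lambda>y. c - \<kappa> * (y \<bullet> y) ^ k - \<mu> * ((y - a) \<bullet> (y - a)) ^ k)"
    and k: "k \<ge> 2"
begin

lemma has_derivative_profile:
  "(g has_derivative (\<lambda>h. (- (2 * real k * \<kappa> * (y \<bullet> y) ^ (k - 1)) *\<^sub>R y
      - (2 * real k * \<mu> * ((y - a) \<bullet> (y - a)) ^ (k - 1)) *\<^sub>R (y - a)) \<bullet> h)) (at y)"
  unfolding g_def
  by (rule derivative_eq_intros has_derivative_inner_power has_derivative_inner_power[of 0, simplified] refl)+
     (simp add: fun_eq_iff algebra_simps)

lemma grad_profile: "grad g a = - (2 * real k * \<kappa> * (a \<bullet> a) ^ (k - 1)) *\<^sub>R a"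
  using grad_eqI[OF has_derivative_profile[of a]] k by simp

lemma hess_profile:
  "hess g a = matrix (\<lambda>h. - (2 * real k * \<kappa>) *\<^sub>R
     ((a \<bullet> a) ^ (k - 1) *\<^sub>R h + (2 * real (k - 1) * (a \<bullet> a) ^ (k - 2) * (a \<bullet> h)) *\<^sub>R a))"
proof (rule hess_eqI[OF open_UNIV UNIV_I has_derivative_profile])
  \<comment> \<open>Stated for a general centre \<open>b\<close> because it is used twice: with
    \<open>b = 0\<close> for the main term, and with \<open>b = a\<close>, where the derivative
    vanishes.\<close>
  have P: "((\<lambda>y. ((y - b) \<bullet> (y - b)) ^ (k - 1) *\<^sub>R (y - b)) has_derivative
     (\<lambda>h. ((a - b) \<bullet> (a - b)) ^ (k - 1) *\<^sub>R h
       + (2 * real (k - 1) * ((a - b) \<bullet> (a - b)) ^ (k - 2) * ((a - b) \<bullet> h)) *\<^sub>R (a - b))) (at a)"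
    for b
    by (rule derivative_eq_intros has_derivative_inner_power refl)+ (simp add: fun_eq_iff numeral_2_eq_2)
  have zero: "(0::real) ^ (k - Suc 0) = 0" using k by (simp add: power_0_left)
  have "((\<lambda>y. - (2 * real k * \<kappa>) *\<^sub>R ((y \<bullet> y) ^ (k - 1) *\<^sub>R y)
      - (2 * real k * \<mu>) *\<^sub>R (((y - a) \<bullet> (y - a)) ^ (k - 1) *\<^sub>R (y - a))) has_derivative
     (\<lambda>h. - (2 * real k * \<kappa>) *\<^sub>R
     ((a \<bullet> a) ^ (k - 1) *\<^sub>R h + (2 * real (k - 1) * (a \<bullet> a) ^ (k - 2) * (a \<bullet> h)) *\<^sub>R a)
     - (2 * real k * \<mu>) *\<^sub>R 0)) (at a)"
    by (intro has_derivative_diff has_derivative_scaleR_right)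
       (use P[of 0] P[of a] k zero in simp_all)
  then show "((\<lambda>y. - (2 * real k * \<kappa> * (y \<bullet> y) ^ (k - 1)) *\<^sub>R y
      - (2 * real k * \<mu> * ((y - a) \<bullet> (y - a)) ^ (k - 1)) *\<^sub>R (y - a)) has_derivative
      (\<lambda>h. - (2 * real k * \<kappa>) *\<^sub>R
     ((a \<bullet> a) ^ (k - 1) *\<^sub>R h + (2 * real (k - 1) * (a \<bullet> a) ^ (k - 2) * (a \<bullet> h)) *\<^sub>R a))) (at a)"
    by simp
qed

text \<open>The Hessian at \<open>a\<close> has the eigenvalue \<open>m * S\<close> on the
  complement of \<open>a\<close> and \<open>m * S * (2 * k - 1)\<close> along \<open>a\<close>,
  where \<open>m = - (2 * k * \<kappa>)\<close> and \<open>S\<close> is the power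
  \<open>2 * k - 2\<close> of \<open>norm a\<close>. The gradient is \<open>m * S\<close> times
  \<open>a\<close>; collecting the powers of \<open>norm a\<close> gives the last exponent.\<close>

lemma Fpq_profile:
  assumes "a \<noteq> 0" and "\<kappa> \<noteq> 0"
  shows "Fpq p q (grad g a) (hess g a) =
    - (2 * real k * \<kappa>) * (2 * real k * \<bar>\<kappa>\<bar>) powr (q - 2)
      * (real CARD('n) + 2 * real k - 2 + (p - 2) * (2 * real k - 1))
      * norm a powr ((2 * real k - 1) * (q - 1) - 1)"
proof -
  define r where "r = norm a"
  have r: "r > 0" using assms(1) by (simp add: r_def)
  have aa: "a \<bullet> a = r ^ 2" by (simp add: r_def power2_norm_eq_inner)
  define S where "S = r ^ (2 * k - 2)"
  have S: "S > 0" using r by (simp add: S_def)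
  have pk1: "(a \<bullet> a) ^ (k - 1) = S" by (simp add: aa S_def power_mult[symmetric] diff_mult_distrib2)
  have "r ^ (2 * (k - 2)) * r ^ 2 = r ^ (2 * (k - 2) + 2)" by (simp only: power_add)
  also have "2 * (k - 2) + 2 = 2 * k - 2" using k by simp
  finally have pk2: "(a \<bullet> a) ^ (k - 2) * r ^ 2 = S" by (simp add: aa S_def power_mult[symmetric])
  define m where "m = - (2 * real k * \<kappa>)"
  have m: "m \<noteq> 0" "\<bar>m\<bar> = 2 * real k * \<bar>\<kappa>\<bar>" using assms(2) k by (auto simp: m_def abs_mult)
  define \<eta> where "\<eta> = grad g a"
  have \<eta>: "\<eta> = (m * S) *\<^sub>R a" unfolding \<eta>_def grad_profile pk1 m_def by simp
  define L where "L h = m *\<^sub>R (S *\<^sub>R h + (2 * real (k - 1) * (a \<bullet> a) ^ (k - 2) * (a \<bullet> h)) *\<^sub>R a)" for h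
  have lin: "linear L"
    by (rule linearI) (simp_all add: L_def algebra_simps inner_add_right)
  have hess: "hess g a = matrix L" unfolding hess_profile L_def[abs_def] pk1 m_def ..
  have rk: "real (k - Suc 0) = real k - 1" using k by simp
  have La: "L a = (m * S * (2 * real k - 1)) *\<^sub>R a"
  proof -
    have "L a = (m * (S + 2 * (real k - 1) * ((a \<bullet> a) ^ (k - 2) * r\<^sup>2))) *\<^sub>R a"
      by (simp add: L_def rk aa algebra_simps flip: scaleR_add_left)
    then show ?thesis unfolding pk2 by (simp add: algebra_simps)
  qed
  have "\<eta> \<bullet> L \<eta> = (m * S)\<^sup>2 * (m * S * (2 * real k - 1)) * r\<^sup>2"
    by (simp add: \<eta> linear_cmul[OF lin] La aa power2_eq_square)
  moreover have n\<eta>: "norm \<eta> = \<bar>m\<bar> * S * r" using S by (simp add: \<eta> r_def abs_mult)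
  ultimately have Q: "(\<eta> \<bullet> L \<eta>) / (norm \<eta>)\<^sup>2 = m * S * (2 * real k - 1)"
    using m(1) S r by (simp add: power_mult_distrib)
  have T: "(\<Sum>i\<in>UNIV. L (axis i 1) $ i) = m * S * (real CARD('n) + 2 * real k - 2)"
  proof -
    have "(\<Sum>i\<in>UNIV. L (axis i 1) $ i) =
        (\<Sum>i\<in>UNIV. m * S + (m * 2 * (real k - 1) * (a \<bullet> a) ^ (k - 2)) * (a $ i * a $ i))"
      by (intro sum.cong refl) (simp add: L_def rk inner_axis algebra_simps)
    also have "\<dots> = m * S * real CARD('n) + (m * 2 * (real k - 1) * (a \<bullet> a) ^ (k - 2)) * (a \<bullet> a)"
      by (simp add: sum.distrib inner_vec_def flip: sum_distrib_left)
    also have "\<dots> = m * S * real CARD('n) + (m * 2 * (real k - 1)) * ((a \<bullet> a) ^ (k - 2) * r\<^sup>2)"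
      by (simp add: aa)
    finally show ?thesis unfolding pk2 by (simp add: algebra_simps)
  qed
  have Sp: "S = r powr (2 * real k - 2)"
    using r k by (simp add: S_def of_nat_diff flip: powr_realpow)
  have "norm \<eta> powr (q - 2) * S = \<bar>m\<bar> powr (q - 2) * (r powr (2 * real k - 1)) powr (q - 2) * S"
  proof -
    have "S * r = r powr (2 * real k - 1)" using r by (simp add: Sp powr_diff power2_eq_square)
    then show ?thesis using r S by (simp add: n\<eta> powr_mult mult.assoc)
  qed
  also have "\<dots> = \<bar>m\<bar> powr (q - 2) * r powr ((2 * real k - 1) * (q - 1) - 1)"
    by (simp add: Sp powr_powr mult.assoc flip: powr_add) (simp add: algebra_simps)
  finally have N: "norm \<eta> powr (q - 2) * S = \<bar>m\<bar> powr (q - 2) * r powr ((2 * real k - 1) * (q - 1) - 1)" .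
  have "Fpq p q (grad g a) (hess g a) = norm \<eta> powr (q - 2) * 
      (m * S * (real CARD('n) + 2 * real k - 2) + (p - 2) * (m * S * (2 * real k - 1)))"
    unfolding hess \<eta>_def[symmetric] Fpq_matrix[OF lin] T times_divide_eq_right[symmetric] Q ..
  also have "\<dots> = m * (norm \<eta> powr (q - 2) * S) * (real CARD('n) + 2 * real k - 2 + (p - 2) * (2 * real k - 1))"
    by (simp add: algebra_simps)
  finally show ?thesis unfolding N m(2) by (simp add: m_def r_def mult_ac)
qed

end

text \<open>The last hypothesis says that the exponent of \<open>norm x\<close> in
  \<open>Fpq_profile\<close> is positive, so the operator tends to 0 at the origin. The condition
  \<open>k \<ge> 2\<close> makes the second derivative vanish at 0.\<close>

lemma admissible_f_power:
  fixes k :: nat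
  assumes "M > 0" "k \<ge> 2" "(2 * real k - 1) * (q - 1) > 1"
  shows "admissible_f TYPE('n::finite) p q (\<lambda>r. M * r ^ (2 * k))"
proof -
  have lim: "((\<lambda>x::real^'n. Fpq p q (grad (\<lambda>y. M * norm y ^ (2 * k)) x) (hess (\<lambda>y. M * norm y ^ (2 * k)) x)) \<longlongrightarrow> 0) (at 0)"
  proof -
    define A where "A = (2 * real k * M) * (2 * real k * M) powr (q - 2)
      * (real CARD('n) + 2 * real k - 2 + (p - 2) * (2 * real k - 1))"
    have "Fpq p q (grad (\<lambda>y. M * norm y ^ (2 * k)) x) (hess (\<lambda>y. M * norm y ^ (2 * k)) x) =
        A * norm x powr ((2 * real k - 1) * (q - 1) - 1)" if "x \<noteq> 0" for x :: "real^'n"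
    proof -
      interpret radial_profile "\<lambda>y::real^'n. M * norm y ^ (2 * k)" 0 "- M" 0 x k
        by unfold_locales (use assms in \<open>auto simp: fun_eq_iff power_mult power2_norm_eq_inner\<close>)
      show ?thesis using Fpq_profile[OF that] assms(1) by (simp add: A_def)
    qed
    then have ev: "\<forall>\<^sub>F x in at (0 :: real^'n). A * norm x powr ((2 * real k - 1) * (q - 1) - 1) =
       Fpq p q (grad (\<lambda>y. M * norm y ^ (2 * k)) x) (hess (\<lambda>y. M * norm y ^ (2 * k)) x)"
      by (auto simp: eventually_at_filter)
    have "((\<lambda>x::real^'n. A * norm x powr ((2 * real k - 1) * (q - 1) - 1)) \<longlongrightarrow> A * 0) (at 0)"
      by (intro tendsto_mult tendsto_const tendsto_zero_powrI[of _ _ _ "(2 * real k - 1) * (q - 1) - 1"])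
         (use assms(3) in \<open>auto intro!: tendsto_eq_intros\<close>)
    then show ?thesis using ev by (auto intro: Lim_transform_eventually)
  qed
  moreover have "\<exists>f' f''. (\<forall>r\<ge>0. ((\<lambda>r. M * r ^ (2 * k)) has_real_derivative f' r) (at r within {0..})) \<and>
        (\<forall>r\<ge>0. (f' has_real_derivative f'' r) (at r within {0..})) \<and>
        continuous_on {0..} f'' \<and>
        M * 0 ^ (2 * k) = 0 \<and> f' 0 = 0 \<and> f'' 0 = 0 \<and> (\<forall>r>0. f'' r > 0)"
  proof (rule exI[of _ "\<lambda>r. M * (real (2 * k) * r ^ (2 * k - 1))"],
      rule exI[of _ "\<lambda>r. M * (real (2 * k) * (real (2 * k - 1) * r ^ (2 * k - 1 - 1)))"], intro conjI allI impI)
    fix r :: real assume "r > 0"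
    moreover have "real (2 * k) > 0" "real (2 * k - 1) > 0" using assms(2) by auto
    ultimately show "0 < M * (real (2 * k) * (real (2 * k - 1) * r ^ (2 * k - 1 - 1)))"
      using assms(1) by (intro mult_pos_pos zero_less_power)
  qed (use assms(2) in \<open>auto intro!: derivative_eq_intros continuous_intros\<close>)
  ultimately show ?thesis unfolding admissible_f_def by simp
qed

lemma admissible_sigma_square: "M > 0 \<Longrightarrow> admissible_sigma (\<lambda>r. M * r\<^sup>2)"
proof -
  assume "M > 0"
  have d: "((\<lambda>r. M * r\<^sup>2) has_real_derivative M * (2 * r)) (at r)" for r
    by (auto intro!: derivative_eq_intros)
  have "(\<lambda>r. M * r\<^sup>2) C1_differentiable_on UNIV"
    unfolding C1_differentiable_on_def
    by (intro exI[of _ "\<lambda>r. M * (2 * r)"])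
       (use d in \<open>auto simp: has_real_derivative_iff_has_vector_derivative intro!: continuous_intros\<close>)
  then show ?thesis
    using \<open>M > 0\<close> DERIV_imp_deriv[OF d[of 0]] by (simp add: admissible_sigma_def)
qed

subsection \<open>Geometry of the horn\<close>

text \<open>Without a minimum, each \<open>x\<close> has a point \<open>Z x\<close> with a smaller
  value, and the regions where \<open>g\<close> exceeds \<open>g (Z x)\<close> cover
  \<open>S\<close>. In a finite subcover the smallest of the values \<open>g (Z c)\<close> is
  exceeded by itself or by a smaller one, a contradiction.\<close>

lemma lsc_attains_inf:
  fixes g :: "'a::topological_space \<Rightarrow> 'b::linorder"
  assumes "compact S" "S \<noteq> {}"
    and lsc: "\<And>x y. x \<in> S \<Longrightarrow> y < g x \<Longrightarrow> \<forall>\<^sub>F z in at x within S. y < g z"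
  shows "\<exists>x\<in>S. \<forall>z\<in>S. g x \<le> g z"
proof (rule ccontr)
  assume "\<not> ?thesis"
  then obtain Z where Z: "\<And>x. x \<in> S \<Longrightarrow> Z x \<in> S \<and> g (Z x) < g x"
    by (metis not_le)
  have "\<exists>U. open U \<and> x \<in> U \<and> (\<forall>z\<in>U \<inter> S. g (Z x) < g z)" if "x \<in> S" for x
  proof -
    have Zx: "g (Z x) < g x" using Z[OF that] by blast
    note ev = lsc[OF that Zx]
    obtain U where "open U" "x \<in> U" "\<And>z. z \<in> U \<Longrightarrow> z \<noteq> x \<Longrightarrow> z \<in> S \<Longrightarrow> g (Z x) < g z"
      using ev unfolding eventually_at_topological by auto
    with Zx show ?thesis by (intro exI[of _ U]) auto
  qed
  then obtain U where U: "\<And>x. x \<in> S \<Longrightarrow> open (U x) \<and> x \<in> U x \<and> (\<forall>z\<in>U x \<inter> S. g (Z x) < g z)"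
    by metis
  obtain C where C: "C \<subseteq> S" "finite C" "S \<subseteq> (\<Union>c\<in>C. U c)"
    by (rule compactE_image[OF assms(1), of S U]) (use U in blast)+
  have "Min ((\<lambda>c. g (Z c)) ` C) \<in> (\<lambda>c. g (Z c)) ` C"
    using C assms(2) by (intro Min_in) auto
  then obtain c0 where "c0 \<in> C" and eq: "g (Z c0) = Min ((\<lambda>c. g (Z c)) ` C)"
    by force
  then have c0: "c0 \<in> C" "\<And>c. c \<in> C \<Longrightarrow> g (Z c0) \<le> g (Z c)"
    using C(2) by auto
  then obtain c where "c \<in> C" "Z c0 \<in> U c"
    using C Z by blast
  then have "g (Z c) < g (Z c0)"
    using U C(1) Z c0(1) by blast
  then show False using c0(2)[OF \<open>c \<in> C\<close>] by simp
qed

text \<open>Lower semicontinuity of a sum with a continuous function. The bound \<open>l\<close> is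
  kept separate from the values of \<open>u\<close>, so that it can be \<open>u \<xi>\<close> at an
  interior point and the boundary datum at a frontier point.\<close>

lemma eventually_less_ereal_add:
  fixes u :: "'a \<Rightarrow> ereal" and h :: "'a \<Rightarrow> real"
  assumes "l \<le> Liminf F u" "l \<noteq> - \<infinity>" "(h \<longlongrightarrow> c) F" "y < l + ereal c"
  shows "\<forall>\<^sub>F z in F. y < u z + ereal (h z)"
proof -
  obtain a where a: "ereal a < l" "y < ereal (a + c)"
  proof (cases y)
    case (real r)
    then have "ereal (r - c) < l"
      using assms(4) by (cases l) (auto simp: ereal_minus_less_iff)
    then obtain a where "ereal (r - c) < ereal a" "ereal a < l"
      using ereal_dense2 by blast
    with that real show ?thesis by auto
  next
    case MInf
    obtain a where "- \<infinity> < ereal a" "ereal a < l"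
      using ereal_dense2[of "- \<infinity>" l] assms(2) by auto
    with that MInf show ?thesis by auto
  qed (use assms(4) in auto)
  have "\<forall>\<^sub>F z in F. ereal a < u z"
    using assms(1) a(1) unfolding le_Liminf_iff by blast
  moreover have "\<forall>\<^sub>F z in F. y < ereal (a + h z)"
    using a(2) tendsto_add[OF tendsto_const[of a] assms(3)] tendsto_ereal order_tendstoD(1) by blast
  ultimately show ?thesis
  proof eventually_elim
    case (elim z)
    have "ereal (a + h z) \<le> u z + ereal (h z)"
      using elim(1) by (cases "u z") auto
    with elim(2) show ?case by (rule less_le_trans)
  qed
qed

section \<open>The horn, its closure and its frontier\<close>

locale horn =
  fixes K s :: real and \<Theta> :: "((real^'n) \<times> real) set"
  assumes K: "K > 0" and s: "s > 0"
    and \<Theta>: "\<Theta> = {(x, t). norm x < K * (- t) powr s \<and> - 1 < t \<and> t < 0}"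
begin

lemma in_\<Theta>: "(x, t) \<in> \<Theta> \<longleftrightarrow> norm x < K * (- t) powr s \<and> - 1 < t \<and> t < 0"
  by (simp add: \<Theta>)

lemma axis_in_\<Theta>: "- 1 < t \<Longrightarrow> t < 0 \<Longrightarrow> (0, t) \<in> \<Theta>"
  using K by (simp add: in_\<Theta>)

lemma open_\<Theta>: "open \<Theta>"
proof -
  let ?U = "{z :: (real^'n) \<times> real. - 1 < snd z} \<inter> {z. snd z < 0}"
  have U: "open ?U"
    by (intro open_Int open_Collect_less continuous_intros)
  have "open (?U \<inter> (\<lambda>z. K * (- snd z) powr s - norm (fst z)) -` {0<..})"
    by (intro continuous_open_preimage[OF _ U open_greaterThan]) (auto intro!: continuous_intros)
  also have "?U \<inter> (\<lambda>z. K * (- snd z) powr s - norm (fst z)) -` {0<..} = \<Theta>"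
    by (auto simp: \<Theta>)
  finally show ?thesis .
qed

lemma powr_le_1: "- 1 \<le> t \<Longrightarrow> t \<le> 0 \<Longrightarrow> e \<ge> 0 \<Longrightarrow> (- t) powr e \<le> (1::real)"
  using powr_mono2[of e "- t" 1] by simp

lemma closure_\<Theta>:
  assumes "(x, t) \<in> closure \<Theta>"
  shows "- 1 \<le> t" "t \<le> 0" "norm x \<le> K * (- t) powr s"
proof -
  let ?f = "\<lambda>z :: (real^'n) \<times> real. K * (- snd z) powr s - norm (fst z)"
  have "closed ((UNIV \<times> {- 1..0}) \<inter> ?f -` {0..})"
    using s by (intro continuous_closed_preimage)
      (auto intro!: closed_Times continuous_intros continuous_on_powr')
  moreover have "\<Theta> \<subseteq> (UNIV \<times> {- 1..0}) \<inter> ?f -` {0..}"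
    by (auto simp: in_\<Theta>)
  ultimately have "(x, t) \<in> (UNIV \<times> {- 1..0}) \<inter> ?f -` {0..}"
    using assms closure_minimal by blast
  then show "- 1 \<le> t" "t \<le> 0" "norm x \<le> K * (- t) powr s" by auto
qed

lemma compact_closure_\<Theta>: "compact (closure \<Theta>)"
proof -
  have "norm x \<le> K" if "(x, t) \<in> \<Theta>" for x t
    using mult_left_mono[OF powr_le_1[of t s], of K] that K s unfolding in_\<Theta> by linarith
  then have "\<Theta> \<subseteq> cball 0 K \<times> {- 1..0}" by (auto simp: in_\<Theta>)
  then have "bounded \<Theta>" by (rule bounded_subset[rotated]) (intro bounded_Times bounded_cball compact_imp_bounded compact_Icc)
  then show ?thesis by (simp add: compact_closure)
qed

text \<open>The frontier consists of points at the bottom \<open>t = - 1\<close>, points of the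
  lateral wall, and the vertex. At \<open>t = 0\<close> the bound \<open>K * 0 powr s\<close> is 0,
  so only the vertex is left there.\<close>

lemma frontier_\<Theta>:
  assumes "(x, t) \<in> frontier \<Theta>"
  shows "- 1 \<le> t" "t \<le> 0" "norm x \<le> K * (- t) powr s" "t < 0 \<Longrightarrow> t = - 1 \<or> norm x = K * (- t) powr s"
    and "t = 0 \<Longrightarrow> x = 0"
proof -
  have *: "(x, t) \<in> closure \<Theta>" "(x, t) \<notin> \<Theta>"
    using assms open_\<Theta> by (auto simp: frontier_def interior_open)
  show "- 1 \<le> t" "t \<le> 0" "norm x \<le> K * (- t) powr s" using closure_\<Theta>[OF *(1)] by auto
  then show "t < 0 \<Longrightarrow> t = - 1 \<or> norm x = K * (- t) powr s" "t = 0 \<Longrightarrow> x = 0" using *(2) by (auto simp: in_\<Theta>)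
qed

text \<open>Transfers a limit at the vertex within the horn to a one-sided limit in time along the
  axis.\<close>

lemma tendsto_axis: "filterlim (\<lambda>t. (0 :: real^'n, t)) (at (0, 0) within \<Theta>) (at_left 0)"
proof -
  have "\<forall>\<^sub>F t in at_left (0::real). t \<in> {- 1<..<0}"
    by (rule eventually_at_left_real) simp
  then have "\<forall>\<^sub>F t in at_left 0. (0, t) \<in> \<Theta> \<and> (0 :: real^'n, t) \<noteq> (0, 0)"
    by eventually_elim (auto intro: axis_in_\<Theta>)
  moreover have "((\<lambda>t. (0 :: real^'n, t)) \<longlongrightarrow> (0, 0)) (at_left 0)"
    by (intro tendsto_intros)
  ultimately show ?thesis unfolding filterlim_at by auto
qed

lemma vertex_in_frontier: "(0, 0) \<in> frontier \<Theta>"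
proof -
  have "(0, 0) \<in> closure \<Theta>"
  proof (rule Lim_in_closed_set[OF closed_closure])
    show "((\<lambda>t. (0 :: real^'n, t)) \<longlongrightarrow> (0, 0)) (at_left (0::real))" by (intro tendsto_intros)
    have "\<forall>\<^sub>F t in at_left (0::real). t \<in> {- 1<..<0}"
      by (rule eventually_at_left_real) simp
    then show "\<forall>\<^sub>F t in at_left 0. (0, t) \<in> closure \<Theta>"
      by eventually_elim (auto intro: axis_in_\<Theta> closure_subset[THEN subsetD])
  qed auto
  then show ?thesis using open_\<Theta> by (simp add: frontier_def interior_open in_\<Theta>)
qed

end

subsection \<open>The barrier\<close>

text \<open>Since \<open>f'\<close> and \<open>f''\<close> vanish at 0, the quotient
  \<open>f' y / y\<close> tends to 0, and the mean value theorem bounds \<open>f r\<close> by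
  \<open>r\<close> times a value of \<open>f'\<close>. This excludes admissible functions that touch
  a concave paraboloid from below at its apex.\<close>

lemma admissible_f_little_o:
  assumes "admissible_f TYPE('n::finite) p q f" and "b > 0"
  shows "\<exists>d>0. \<forall>r. 0 < r \<and> r < d \<longrightarrow> f r < b * r\<^sup>2"
proof -
  obtain f' f'' where f: "\<And>r. r \<ge> 0 \<Longrightarrow> (f has_real_derivative f' r) (at r within {0..})"
      "\<And>r. r \<ge> 0 \<Longrightarrow> (f' has_real_derivative f'' r) (at r within {0..})"
      "f 0 = 0" "f' 0 = 0" "f'' 0 = 0"
    using assms(1) unfolding admissible_f_def by auto
  have "((\<lambda>y. f' y / y) \<longlongrightarrow> 0) (at 0 within {0..})"
    using f(2)[of 0] f(4,5) by (simp add: has_field_derivative_iff)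
  then have "\<forall>\<^sub>F y in at 0 within {0..}. f' y / y < b"
    using assms(2) by (rule order_tendstoD(2))
  then obtain d where d: "d > 0" "\<And>y. 0 < y \<Longrightarrow> y < d \<Longrightarrow> f' y / y < b"
    unfolding eventually_at by (auto simp: dist_real_def)
  have "f r < b * r\<^sup>2" if r: "0 < r" "r < d" for r
  proof -
    have "\<exists>y\<in>{0<..<r}. f r - f 0 = f' y * (r - 0)"
    proof (rule mvt_simple[OF r(1), of f "\<lambda>y h. f' y * h"])
      show "(f has_derivative (*) (f' y)) (at y within {0..r})" if "0 \<le> y" "y \<le> r" for y
        using f(1)[OF that(1)] unfolding has_field_derivative_def by (rule has_derivative_subset) auto
    qed
    then obtain y where y: "0 < y" "y < r" "f r = f' y * r" using f(3) by auto
    have "f' y < b * y" using d(2)[of y] y r by (simp add: divide_simps)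
    also have "\<dots> \<le> b * r" using y assms(2) by simp
    finally show ?thesis using y(3) r by (simp add: power2_eq_square)
  qed
  with d(1) show ?thesis by blast
qed

lemma touches_belowD:
  assumes "open \<Theta>" "\<xi> \<in> \<Theta>" "touches_below \<Theta> \<phi> (\<lambda>z. ereal (w z)) \<xi>"
  shows "\<phi> \<xi> = w \<xi>" and "\<forall>\<^sub>F \<eta> in at \<xi>. \<phi> \<eta> < w \<eta>"
  using assms(3) by (simp_all add: touches_below_def at_within_open[OF assms(2,1)])

text \<open>Off the axis, touching fixes the gradient and the time derivative of the test function,
  and \<open>Fpq_le\<close> bounds the operator; \<open>ineq\<close> is the resulting inequality. On
  the axis no admissible function touches.\<close>

lemma paraboloid_supersolution:
  fixes \<Theta> :: "((real^'n) \<times> real) set" and a b a' b' :: "real \<Rightarrow> real"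
  assumes "open \<Theta>" and "p > 1"
    and a: "\<And>x t. (x, t) \<in> \<Theta> \<Longrightarrow> (a has_real_derivative a' t) (at t)"
    and b: "\<And>x t. (x, t) \<in> \<Theta> \<Longrightarrow> (b has_real_derivative b' t) (at t)"
    and b_pos: "\<And>x t. (x, t) \<in> \<Theta> \<Longrightarrow> b t > 0"
    and ineq: "\<And>x t. (x, t) \<in> \<Theta> \<Longrightarrow> x \<noteq> 0 \<Longrightarrow>
      a' t - b' t * (norm x)\<^sup>2 + 2 * b t * (2 * b t * norm x) powr (q - 2) * (real CARD('n) + p - 2) \<ge> 0"
  shows "viscosity_supersolution p q \<Theta> (\<lambda>z. ereal (a (snd z) - b (snd z) * (fst z \<bullet> fst z)))"
    (is "viscosity_supersolution p q \<Theta> (\<lambda>z. ereal (?w z))")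
  unfolding viscosity_supersolution_def
proof (intro conjI ballI allI impI)
  fix \<xi> assume \<xi>: "\<xi> \<in> \<Theta>"
  obtain x t where xt: "\<xi> = (x, t)" by force
  have "isCont a t" "isCont b t"
    using a b \<xi> xt DERIV_isCont by blast+
  then have "isCont (\<lambda>z. a (snd z)) \<xi>" "isCont (\<lambda>z. b (snd z)) \<xi>"
    using isCont_o2[where f = snd and g = a and a = \<xi>] isCont_o2[where f = snd and g = b and a = \<xi>] xt by (auto intro!: continuous_intros)
  then have "isCont ?w \<xi>" by (intro continuous_intros)
  then have lim: "((\<lambda>z. ereal (?w z)) \<longlongrightarrow> ereal (?w \<xi>)) (at \<xi> within \<Theta>)"
    unfolding isCont_def using tendsto_within_subset[of ?w _ \<xi> UNIV \<Theta>] by auto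
  show "ereal (?w \<xi>) \<le> Liminf (at \<xi> within \<Theta>) (\<lambda>z. ereal (?w z))"
    unfolding le_Liminf_iff using order_tendstoD(1)[OF lim] by blast
next
  fix \<phi> \<xi>
  assume \<xi>: "\<xi> \<in> \<Theta>" and "C2_on \<phi> \<Theta> \<and> admissible_at p q \<Theta> \<phi> \<xi> \<and> touches_below \<Theta> \<phi> (\<lambda>z. ereal (?w z)) \<xi>"
  then have \<phi>: "C2_on \<phi> \<Theta>" "admissible_at p q \<Theta> \<phi> \<xi>" and tb: "touches_below \<Theta> \<phi> (\<lambda>z. ereal (?w z)) \<xi>"
    by auto
  note T = touches_belowD[OF assms(1) \<xi> tb]
  obtain x t where xt: "\<xi> = (x, t)" by force
  have in\<Theta>: "(x, t) \<in> \<Theta>" using \<xi> xt by simp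
  have eq: "\<phi> (x, t) = a t - b t * (x \<bullet> x)" using T(1) xt by simp
  have le: "\<forall>\<^sub>F \<eta> in nhds (x, t). \<phi> \<eta> \<le> a (snd \<eta>) - b (snd \<eta>) * (fst \<eta> \<bullet> fst \<eta>)"
    using T(2) unfolding eventually_at_filter xt
  proof eventually_elim
    case (elim \<eta>)
    then show ?case using eq by (cases "\<eta> = (x, t)") auto
  qed
  note P = touching_paraboloid[OF assms(1) in\<Theta> \<phi>(1) a[OF in\<Theta>] b[OF in\<Theta>] eq le]
  have bt: "b t > 0" using b_pos in\<Theta> .
  \<comment> \<open>On the axis the gradient of \<open>\<phi>\<close> vanishes, so admissibility
    gives \<open>\<phi> (y, t) \<ge> a t - f (norm y)\<close>. Touching requires a value below
    \<open>a t - b t * r\<^sup>2\<close> at \<open>norm y = r\<close>, but \<open>f r\<close> is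
    smaller than \<open>b t * r\<^sup>2\<close> for small \<open>r\<close>.\<close>
  have "x \<noteq> 0"
  proof
    assume x: "x = 0"
    have "grad_x \<phi> (x, t) = 0" using P(1) x by simp
    then obtain \<delta> f \<sigma> where "\<delta> > 0" and f: "admissible_f TYPE('n) p q f" and \<sigma>: "admissible_sigma \<sigma>"
      and le: "\<And>y \<tau>. norm y < \<delta> \<Longrightarrow> \<bar>\<tau> - t\<bar> < \<delta> \<Longrightarrow>
         \<bar>\<phi> (y, \<tau>) - \<phi> (x, t) - dt \<phi> (x, t) * (\<tau> - t)\<bar> \<le> f (norm y) + \<sigma> (\<tau> - t)"
      using \<phi>(2) unfolding admissible_at_def xt x by (auto simp: dist_norm abs_less_iff)
    obtain d where d: "d > 0" "\<And>r. 0 < r \<Longrightarrow> r < d \<Longrightarrow> f r < b t * r\<^sup>2"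
      using admissible_f_little_o[OF f bt] by blast
    obtain e where e: "e > 0" "\<And>\<eta>. \<eta> \<noteq> \<xi> \<Longrightarrow> dist \<eta> \<xi> < e \<Longrightarrow> \<phi> \<eta> < ?w \<eta>"
      using T(2) unfolding eventually_at by auto
    define r where "r = min \<delta> (min d e) / 2"
    have r: "0 < r" "r < \<delta>" "r < d" "r < e" using \<open>\<delta> > 0\<close> d(1) e(1) by (auto simp: r_def)
    define y :: "real^'n" where "y = r *\<^sub>R axis undefined 1"
    have y: "norm y = r" "y \<noteq> 0" using r(1) by (auto simp: y_def norm_axis_1)
    have "\<phi> (y, t) < a t - b t * r\<^sup>2"
      using e(2)[of "(y, t)"] y r xt x by (auto simp: dist_Pair_Pair power2_norm_eq_inner[symmetric])
    moreover have "\<phi> (y, t) - a t \<ge> - f r"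
      using le[of y t] y r \<sigma> eq x \<open>\<delta> > 0\<close> by (auto simp: admissible_sigma_def)
    ultimately show False using d(2)[OF r(1,3)] by linarith
  qed
  define \<eta> where "\<eta> = grad_x \<phi> (x, t)"
  have \<eta>: "\<eta> \<noteq> 0" "norm \<eta> = 2 * b t * norm x"
    using P(1) \<open>x \<noteq> 0\<close> bt by (auto simp: \<eta>_def)
  obtain L where L: "linear L" "hess_x \<phi> (x, t) = matrix L" "\<And>z. z \<bullet> L z \<le> - (2 * b t) * (z \<bullet> z)"
    using P(3) by auto
  have "Lpq p q \<phi> (x, t) \<le> - (2 * b t) * (2 * b t * norm x) powr (q - 2) * (real CARD('n) + p - 2)"
    using Fpq_le[OF L(1,3) \<eta>(1), of p q] assms(2) unfolding Lpq_def L(2) \<eta>_def[symmetric] \<eta>(2) by simp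
  then have "dt \<phi> (x, t) - Lpq p q \<phi> (x, t) \<ge> 0"
    using ineq[OF in\<Theta> \<open>x \<noteq> 0\<close>] P(2) by (simp add: power2_norm_eq_inner)
  then show "if grad_x \<phi> \<xi> \<noteq> 0 then dt \<phi> \<xi> - Lpq p q \<phi> \<xi> \<ge> 0 else dt \<phi> \<xi> \<ge> 0"
    using \<eta>(1) by (simp add: xt \<eta>_def)
qed (simp_all add: closure_subset)

lemma (in horn) barrier_exists:
  assumes "p > 1" "1 < q" "q < 2"
  shows "\<exists>w. barrier p q \<Theta> (0, 0) w"
proof -
  \<comment> \<open>The diffusion term is of order \<open>\<gamma> * (q - 1) + s * (q - 2)\<close>
    in \<open>- t\<close> at the lateral wall, the time derivative of order
    \<open>\<alpha> - 1\<close>. This \<open>\<gamma>\<close> makes the former exponent the smaller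
    one, hence the power the larger one for \<open>- t \<le> 1\<close>.\<close>
  define \<gamma> where "\<gamma> = (1 + s * q) / (2 - q)"
  define \<alpha> where "\<alpha> = \<gamma> + 2 * s"
  define N where "N = real CARD('n) + p - 2"
  have N: "N > 0"
    using assms(1) zero_less_card_finite[where 'a='n] unfolding N_def by linarith
  have \<gamma>: "\<gamma> > 0" using assms s by (simp add: \<gamma>_def add_pos_pos)
  have \<alpha>: "\<alpha> > 0" using \<gamma> s by (simp add: \<alpha>_def)
  have expo: "\<gamma> * (q - 1) + s * (q - 2) \<le> \<alpha> - 1"
  proof -
    have "\<gamma> * (2 - q) = 1 + s * q" using assms by (simp add: \<gamma>_def)
    then show ?thesis using s by (simp add: \<alpha>_def algebra_simps)
  qed
  \<comment> \<open>Equating the coefficients of the time derivative and of the diffusion term, as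
    in \<open>BR\<close> below, leaves \<open>B powr (2 - q) = R\<close>.\<close>
  define R where "R = 2 powr (q - 1) * N * K powr (q - 2) / (2 * K\<^sup>2 * \<alpha>)"
  have R: "R > 0" using N K \<alpha> by (simp add: R_def)
  define B where "B = R powr (1 / (2 - q))"
  have B: "B > 0" using R by (simp add: B_def)
  have "B = B powr (q - 1) * B powr (2 - q)" using B by (simp flip: powr_add)
  also have "B powr (2 - q) = R" using R assms by (simp add: B_def powr_powr)
  finally have BR: "2 * B * K\<^sup>2 * \<alpha> = (2 * B) powr (q - 1) * N * K powr (q - 2)"
    using K \<alpha> B unfolding R_def by (simp add: powr_mult field_simps)
  \<comment> \<open>In the horn the quadratic term is at most
    \<open>B * K\<^sup>2 * (- t) powr \<alpha>\<close>. The factor 2 therefore leaves the same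
    amount as a positive lower bound for \<open>w\<close>.\<close>
  define a where "a t = 2 * B * K\<^sup>2 * (- t) powr \<alpha>" for t
  define b where "b t = B * (- t) powr \<gamma>" for t
  define w where "w z = a (snd z) - b (snd z) * (fst z \<bullet> fst z)" for z :: "(real^'n) \<times> real"
  have lower: "w (x, t) \<ge> B * K\<^sup>2 * (- t) powr \<alpha>" if "(x, t) \<in> \<Theta>" for x t
  proof -
    have "(norm x)\<^sup>2 \<le> (K * (- t) powr s)\<^sup>2"
      using that by (intro power_mono) (auto simp: in_\<Theta>)
    also have "\<dots> = K\<^sup>2 * (- t) powr (2 * s)"
      using that by (simp add: power_mult_distrib powr_power in_\<Theta> mult.commute)
    finally have "b t * (norm x)\<^sup>2 \<le> b t * (K\<^sup>2 * (- t) powr (2 * s))"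
      using B by (intro mult_left_mono) (auto simp: b_def)
    also have "\<dots> = B * K\<^sup>2 * (- t) powr \<alpha>"
      by (simp add: b_def \<alpha>_def powr_add)
    finally show ?thesis by (simp add: w_def a_def power2_norm_eq_inner algebra_simps)
  qed
  have upper: "w (x, t) \<le> a t" for x t
    using B by (simp add: w_def b_def)
  have super: "viscosity_supersolution p q \<Theta> (\<lambda>z. ereal (w z))"
    unfolding w_def
  proof (rule paraboloid_supersolution[OF open_\<Theta> assms(1)])
    fix x t assume xt: "(x, t) \<in> \<Theta>"
    then have t: "- t > 0" "- t \<le> 1" and x: "norm x < K * (- t) powr s" by (auto simp: in_\<Theta>)
    show "(a has_real_derivative - (2 * B * K\<^sup>2 * \<alpha> * (- t) powr (\<alpha> - 1))) (at t)"
      unfolding a_def using t by (auto intro!: derivative_eq_intros simp: powr_diff field_simps)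
    show "(b has_real_derivative - (B * \<gamma> * (- t) powr (\<gamma> - 1))) (at t)"
      unfolding b_def using t by (auto intro!: derivative_eq_intros simp: powr_diff field_simps)
    show bt: "b t > 0" using B t by (simp add: b_def)
    assume "x \<noteq> 0"
    have "2 * B * K\<^sup>2 * \<alpha> * (- t) powr (\<alpha> - 1) \<le> (2 * B) powr (q - 1) * N * K powr (q - 2) * (- t) powr (\<gamma> * (q - 1) + s * (q - 2))"
      unfolding BR using t N expo by (intro mult_left_mono powr_mono') auto
    also have "\<dots> = (2 * b t) powr (q - 1) * (K * (- t) powr s) powr (q - 2) * N"
      using t K B by (simp add: b_def powr_mult powr_powr powr_add)
    \<comment> \<open>As \<open>q - 2\<close> is negative, the power of \<open>norm x\<close> is
      smallest at the lateral wall.\<close>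
    also have "\<dots> \<le> (2 * b t) powr (q - 1) * norm x powr (q - 2) * N"
      using x \<open>x \<noteq> 0\<close> assms N by (intro mult_right_mono mult_left_mono powr_mono2') auto
    also have "\<dots> = 2 * b t * (2 * b t * norm x) powr (q - 2) * N"
    proof -
      have "(2 * b t) powr (q - 1) = (2 * b t) powr (1 + (q - 2))" by simp
      also have "\<dots> = 2 * b t * (2 * b t) powr (q - 2)" using bt by (simp only: powr_add) simp
      finally show ?thesis using bt by (simp add: powr_mult)
    qed
    finally have "2 * B * K\<^sup>2 * \<alpha> * (- t) powr (\<alpha> - 1) \<le> 2 * b t * (2 * b t * norm x) powr (q - 2) * N" .
    moreover have "0 \<le> B * \<gamma> * (- t) powr (\<gamma> - 1) * (norm x)\<^sup>2"
      using B \<gamma> by simp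
    ultimately show "- (2 * B * K\<^sup>2 * \<alpha> * (- t) powr (\<alpha> - 1)) - - (B * \<gamma> * (- t) powr (\<gamma> - 1)) * (norm x)\<^sup>2
        + 2 * b t * (2 * b t * norm x) powr (q - 2) * (real CARD('n) + p - 2) \<ge> 0"
      unfolding N_def[symmetric] mult_minus_left diff_minus_eq_add by linarith
  qed
  have pos: "w \<zeta> > 0" if "\<zeta> \<in> \<Theta>" for \<zeta>
  proof -
    obtain x t where \<zeta>: "\<zeta> = (x, t)" by force
    have "0 < B * K\<^sup>2 * (- t) powr \<alpha>" using that B K by (simp add: \<zeta> in_\<Theta>)
    with lower[of x t] that show ?thesis by (simp add: \<zeta>)
  qed
  have in_ev: "\<forall>\<^sub>F \<zeta> in at \<xi> within \<Theta>. \<zeta> \<in> \<Theta>" for \<xi>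
    by (simp add: eventually_at_filter)
  have "(w \<longlongrightarrow> 0) (at (0, 0) within \<Theta>)"
  proof (rule tendsto_sandwich[of "\<lambda>_. 0" _ _ "\<lambda>z. a (snd z)"])
    show "\<forall>\<^sub>F \<zeta> in at (0, 0) within \<Theta>. 0 \<le> w \<zeta>"
      using in_ev by eventually_elim (use pos less_imp_le in blast)
    show "\<forall>\<^sub>F \<zeta> in at (0, 0) within \<Theta>. w \<zeta> \<le> a (snd \<zeta>)"
      using upper by (intro always_eventually allI) (metis prod.collapse)
    have "((\<lambda>z. (- snd z) powr \<alpha>) \<longlongrightarrow> 0) (at (0 :: real^'n, 0) within \<Theta>)"
    proof (rule tendsto_zero_powrI)
      show "((\<lambda>z. - snd z) \<longlongrightarrow> 0) (at (0 :: real^'n, 0 :: real) within \<Theta>)"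
        by (auto intro!: tendsto_eq_intros)
      show "\<forall>\<^sub>F z in at (0, 0) within \<Theta>. 0 \<le> - snd z"
        using in_ev by eventually_elim (auto simp: \<Theta>)
    qed (use \<alpha> in auto)
    then show "((\<lambda>z. a (snd z)) \<longlongrightarrow> 0) (at (0, 0) within \<Theta>)"
      unfolding a_def by (rule tendsto_mult_right_zero)
  qed auto
  then have lim: "((\<lambda>z. ereal (w z)) \<longlongrightarrow> 0) (at (0, 0) within \<Theta>)"
    using tendsto_ereal zero_ereal_def by metis
  have "Liminf (at \<xi> within \<Theta>) (\<lambda>z. ereal (w z)) > 0" if "\<xi> \<in> frontier \<Theta> - {(0, 0)}" for \<xi>
  proof -
    obtain x t where \<xi>: "\<xi> = (x, t)" by force
    have t: "t < 0" using that frontier_\<Theta>[of x t] by (force simp: \<xi>)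
    \<comment> \<open>Near \<open>\<xi>\<close> the time stays below \<open>t / 2\<close>, so
      \<open>m\<close> bounds \<open>w\<close> from below there.\<close>
    define m where "m = B * K\<^sup>2 * (- t / 2) powr \<alpha>"
    have "((\<lambda>z. snd z) \<longlongrightarrow> t) (at \<xi> within \<Theta>)" by (auto intro!: tendsto_eq_intros simp: \<xi>)
    then have "\<forall>\<^sub>F z in at \<xi> within \<Theta>. snd z < t / 2" using t by (intro order_tendstoD) auto
    then have "\<forall>\<^sub>F z in at \<xi> within \<Theta>. ereal m \<le> ereal (w z)"
      using in_ev
    proof eventually_elim
      case (elim z)
      have "m \<le> B * K\<^sup>2 * (- snd z) powr \<alpha>"
        using elim(1) t B \<alpha> unfolding m_def by (intro mult_left_mono powr_mono2) auto
      also have "\<dots> \<le> w z" using lower[of "fst z" "snd z"] elim(2) by simp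
      finally show ?case by simp
    qed
    then have "ereal m \<le> Liminf (at \<xi> within \<Theta>) (\<lambda>z. ereal (w z))" by (rule Liminf_bounded)
    moreover have "m > 0" using t B K by (simp add: m_def)
    ultimately show ?thesis by (metis ereal_less(2) less_le_trans)
  qed
  then have "barrier p q \<Theta> (0, 0) (\<lambda>z. ereal (w z))"
    unfolding barrier_def using vertex_in_frontier pos super lim by simp
  then show ?thesis by blast
qed

subsection \<open>The subsolution\<close>

lemma has_real_derivative_powr_minus:
  "t < 0 \<Longrightarrow> ((\<lambda>t. (- t) powr e) has_real_derivative - (e * (- t) powr (e - 1))) (at t)"
  by (auto intro!: derivative_eq_intros simp: powr_diff field_simps)

text \<open>The spatial part is bounded by a multiple of the power \<open>2 * k\<close> of
  \<open>norm x\<close>, which \<open>admissible_f_power\<close> accepts. The remainder of the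
  first-order expansion in time is bounded by a multiple of \<open>(t - t0)\<^sup>2\<close>.\<close>

lemma admissible_at_axis:
  fixes \<Theta> :: "((real^'n) \<times> real) set" and k :: nat
  assumes "open \<Theta>" "(0, t0) \<in> \<Theta>" and k: "k \<ge> 2" "(2 * real k - 1) * (q - 1) > 1"
    and \<alpha>: "\<forall>\<^sub>F t in nhds t0. (\<alpha> has_real_derivative \<alpha>' t) (at t)"
    and \<alpha>': "(\<alpha>' has_real_derivative \<alpha>'') (at t0)"
    and \<beta>: "isCont \<beta> t0"
    and \<phi>: "\<And>x t. \<phi> (x, t) = \<alpha> t - \<beta> t * (x \<bullet> x) ^ k"
  shows "admissible_at p q \<Theta> \<phi> (0, t0)" and "dt \<phi> (0, t0) = \<alpha>' t0"
proof -
  show dt: "dt \<phi> (0, t0) = \<alpha>' t0"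
    using eventually_nhds_x_imp_x[OF \<alpha>] k by (simp add: dt_def \<phi> power_0_left DERIV_imp_deriv)
  \<comment> \<open>\<open>M\<close> exceeds the limit of the difference quotients of
    \<open>\<alpha>'\<close> at \<open>t0\<close> in absolute value, so \<open>\<alpha>'\<close>
    deviates from \<open>\<alpha>' t0\<close> by at most \<open>M * \<bar>t - t0\<bar>\<close>
    nearby.\<close>
  define M where "M = \<bar>\<alpha>''\<bar> + 1"
  define B where "B = \<bar>\<beta> t0\<bar> + 1"
  have MB: "M > 0" "B > 0" by (auto simp: M_def B_def)
  have "((\<lambda>t. (\<alpha>' t - \<alpha>' t0) / (t - t0)) \<longlongrightarrow> \<alpha>'') (at t0)"
    using \<alpha>' by (simp add: has_field_derivative_iff)
  then have "((\<lambda>t. \<bar>(\<alpha>' t - \<alpha>' t0) / (t - t0)\<bar>) \<longlongrightarrow> \<bar>\<alpha>''\<bar>) (at t0)"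
    by (rule tendsto_rabs)
  then have "\<forall>\<^sub>F t in at t0. \<bar>(\<alpha>' t - \<alpha>' t0) / (t - t0)\<bar> < M"
    by (rule order_tendstoD) (simp add: M_def)
  then have "\<forall>\<^sub>F t in nhds t0. \<bar>\<alpha>' t - \<alpha>' t0\<bar> \<le> M * \<bar>t - t0\<bar>"
    unfolding eventually_at_filter
    by eventually_elim (use MB in \<open>auto simp: abs_divide divide_simps split: if_splits\<close>)
  moreover have "\<forall>\<^sub>F t in nhds t0. \<bar>\<beta> t\<bar> < B"
    using \<beta> unfolding isCont_def tendsto_at_iff_tendsto_nhds
    by (intro order_tendstoD(2)[OF tendsto_rabs]) (auto simp: B_def)
  ultimately have "\<forall>\<^sub>F t in nhds t0. \<bar>\<alpha>' t - \<alpha>' t0\<bar> \<le> M * \<bar>t - t0\<bar> \<and> \<bar>\<beta> t\<bar> < B \<and> (\<alpha> has_real_derivative \<alpha>' t) (at t)"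
    using \<alpha> by eventually_elim auto
  then obtain d where d: "d > 0" "\<And>t. \<bar>t - t0\<bar> < d \<Longrightarrow> \<bar>\<alpha>' t - \<alpha>' t0\<bar> \<le> M * \<bar>t - t0\<bar>"
     "\<And>t. \<bar>t - t0\<bar> < d \<Longrightarrow> \<bar>\<beta> t\<bar> < B" "\<And>t. \<bar>t - t0\<bar> < d \<Longrightarrow> (\<alpha> has_real_derivative \<alpha>' t) (at t)"
    unfolding eventually_nhds_metric by (auto simp: dist_real_def)
  obtain A I where AI: "open A" "open I" "(0, t0) \<in> A \<times> I" "A \<times> I \<subseteq> \<Theta>"
    using open_prod_elim[OF assms(1,2)] by metis
  then obtain e1 e2 where e: "e1 > 0" "ball 0 e1 \<subseteq> A" "e2 > 0" "ball t0 e2 \<subseteq> I"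
    by (metis openE mem_Sigma_iff)
  define \<delta> where "\<delta> = min d (min e1 e2)"
  \<comment> \<open>The mean value inequality is applied to \<open>\<alpha>\<close> minus its
    tangent at \<open>t0\<close>, whose derivative is at most \<open>M * \<bar>t - t0\<bar>\<close>
    on the segment.\<close>
  have taylor: "\<bar>\<alpha> t - \<alpha> t0 - \<alpha>' t0 * (t - t0)\<bar> \<le> M * (t - t0)\<^sup>2" if t: "\<bar>t - t0\<bar> < d" for t
  proof -
    have der: "((\<lambda>t. \<alpha> t - \<alpha>' t0 * (t - t0)) has_derivative (\<lambda>h. (\<alpha>' x - \<alpha>' t0) * h)) (at x within closed_segment t0 t)"
      if "x \<in> closed_segment t0 t" for x
    proof -
      have "\<bar>x - t0\<bar> < d" using segment_bound1[OF that] t by (simp add: abs_minus_commute)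
      then have "((\<lambda>t. \<alpha> t - \<alpha>' t0 * (t - t0)) has_real_derivative \<alpha>' x - \<alpha>' t0) (at x)"
        by (auto intro!: derivative_eq_intros d(4))
      then show ?thesis unfolding has_field_derivative_def by (rule has_derivative_at_withinI)
    qed
    have "norm ((\<alpha> t - \<alpha>' t0 * (t - t0)) - (\<alpha> t0 - \<alpha>' t0 * (t0 - t0))) \<le> (M * \<bar>t - t0\<bar>) * norm (t - t0)"
    proof (rule differentiable_bound[OF convex_closed_segment der])
      fix x assume x: "x \<in> closed_segment t0 t"
      have xt: "\<bar>x - t0\<bar> \<le> \<bar>t - t0\<bar>" using segment_bound1[OF x] by (simp add: abs_minus_commute)
      have "\<bar>\<alpha>' x - \<alpha>' t0\<bar> \<le> M * \<bar>x - t0\<bar>" using d(2) xt t by simp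
      also have "\<dots> \<le> M * \<bar>t - t0\<bar>" using xt MB by simp
      finally show "onorm ((*) (\<alpha>' x - \<alpha>' t0)) \<le> M * \<bar>t - t0\<bar>"
        by (intro onorm_le) (auto simp: abs_mult intro!: mult_right_mono)
    qed auto
    then show ?thesis by (simp add: power2_eq_square mult.assoc abs_mult_self_eq algebra_simps)
  qed
  have bound: "\<bar>\<phi> (x, t) - \<phi> (0, t0) - dt \<phi> (0, t0) * (t - t0)\<bar> \<le> B * norm x ^ (2 * k) + M * (t - t0)\<^sup>2"
    if "\<bar>t - t0\<bar> < d" for x t
  proof -
    have "\<bar>\<beta> t * (x \<bullet> x) ^ k\<bar> \<le> B * norm x ^ (2 * k)"
      using d(3)[OF that] by (auto simp: abs_mult power_mult power2_norm_eq_inner intro!: mult_right_mono)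
    moreover have "\<phi> (x, t) - \<phi> (0, t0) - dt \<phi> (0, t0) * (t - t0)
       = (\<alpha> t - \<alpha> t0 - \<alpha>' t0 * (t - t0)) - \<beta> t * (x \<bullet> x) ^ k"
      using k by (simp add: \<phi> dt power_0_left)
    ultimately show ?thesis using taylor[OF that] by linarith
  qed
  have "\<delta> > 0" using d(1) e by (simp add: \<delta>_def)
  moreover have "ball 0 \<delta> \<times> {t0 - \<delta><..<t0 + \<delta>} \<subseteq> \<Theta>"
  proof -
    have "ball 0 \<delta> \<subseteq> ball 0 e1" "{t0 - \<delta><..<t0 + \<delta>} \<subseteq> ball t0 e2"
      by (auto simp: \<delta>_def dist_real_def)
    with AI(4) e(2,4) show ?thesis by blast
  qed
  moreover have "\<bar>t - t0\<bar> < d" if "t \<in> {t0 - \<delta><..<t0 + \<delta>}" for t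
    using that by (auto simp: \<delta>_def)
  ultimately show "admissible_at p q \<Theta> \<phi> (0, t0)"
    unfolding admissible_at_def fst_conv snd_conv
    using admissible_f_power[OF MB(2) k] admissible_sigma_square[OF MB(1)] bound
    by (intro disjI2 exI[of _ \<delta>] conjI exI[of _ "\<lambda>r. B * r ^ (2 * k)"] exI[of _ "\<lambda>r. M * r\<^sup>2"]) auto
qed

lemma viscosity_supersolutionD:
  assumes "viscosity_supersolution p q \<Theta> u" "C2_on \<phi> \<Theta>" "\<xi> \<in> \<Theta>"
    "admissible_at p q \<Theta> \<phi> \<xi>" "touches_below \<Theta> \<phi> u \<xi>"
  shows "if grad_x \<phi> \<xi> \<noteq> 0 then dt \<phi> \<xi> - Lpq p q \<phi> \<xi> \<ge> 0 else dt \<phi> \<xi> \<ge> 0"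
  using assms unfolding viscosity_supersolution_def by blast

locale horn_subsolution = horn K s \<Theta> for K s and \<Theta> :: "((real^'n) \<times> real) set" +
  fixes p q :: real and k :: nat
  assumes p: "p > 1" and q: "1 < q" "q < 2" and sq: "s * q < 1"
    and k: "k \<ge> 2" "(2 * real k - 1) * (q - 1) > 1"
begin

text \<open>With \<open>\<tau> = - t\<close>, the operator applied to \<open>v\<close> is at least \<open>- C * (1 - s * q) * \<tau> powr (- s * q)\<close> in the horn.
  This is integrable up to \<open>\<tau> = 0\<close> because \<open>s * q < 1\<close>, which determines the term of \<open>v\<close> that depends on \<open>t\<close> only.\<close>

definition "N = real CARD('n) + 2 * real k - 2 + (p - 2) * (2 * real k - 1)"
definition "E = (2 * real k - 1) * (q - 1) - 1"
definition "C = (2 * real k) powr (q - 1) * N * K powr E / (1 - s * q)"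
text \<open>The exponent normalises the radial term of \<open>v\<close>: it equals
  \<open>K ^ (2 * k)\<close> on the lateral wall.\<close>

definition "\<beta> t = (- t) powr (- (2 * real k * s))"
definition "v z = K ^ (2 * k) + C * (- snd z) powr (1 - s * q) - \<beta> (snd z) * (fst z \<bullet> fst z) ^ k"
  for z :: "(real^'n) \<times> real"

lemma N_pos: "N > 0"
proof -
  have "(p - 1) * (2 * real k - 1) > 0" using p k by (intro mult_pos_pos) auto
  moreover have "N = (p - 1) * (2 * real k - 1) + (real CARD('n) - 1)"
    by (simp add: N_def algebra_simps)
  moreover have "real CARD('n) \<ge> 1" using zero_less_card_finite[where 'a='n] by linarith
  ultimately show ?thesis by linarith
qed

lemma C_pos: "C > 0"
  using N_pos K sq k by (simp add: C_def)

lemma v_le: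
  assumes "- 1 \<le> t" "t \<le> 0"
  shows "v (x, t) \<le> K ^ (2 * k) + C"
proof -
  have "\<beta> t * (x \<bullet> x) ^ k \<ge> 0" by (simp add: \<beta>_def)
  moreover have "C * (- t) powr (1 - s * q) \<le> C"
    using mult_left_mono[OF powr_le_1[OF assms, of "1 - s * q"], of C] C_pos sq by simp
  ultimately show ?thesis by (simp add: v_def)
qed

text \<open>On the lateral wall the radial term of \<open>v\<close> cancels the constant
  \<open>K ^ (2 * k)\<close>. At the bottom all powers of \<open>- t\<close> equal 1 and the radial
  term has the right sign.\<close>

lemma v_le_boundary:
  assumes "(x, t) \<in> frontier \<Theta>" "t < 0"
  shows "v (x, t) \<le> (K ^ (2 * k) + C) * (- t) powr (1 - s * q)"
proof (cases "t = - 1")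
  case True
  then show ?thesis by (simp add: v_def \<beta>_def)
next
  case False
  then have "norm x = K * (- t) powr s"
    using frontier_\<Theta>(4)[OF assms] by simp
  then have "(x \<bullet> x) ^ k = K ^ (2 * k) * ((- t) powr s) ^ (2 * k)"
    by (simp add: power_mult power_mult_distrib flip: power2_norm_eq_inner)
  also have "((- t) powr s) ^ (2 * k) = (- t) powr (2 * real k * s)"
    using assms by (simp add: powr_power mult.commute)
  finally have "\<beta> t * (x \<bullet> x) ^ k = K ^ (2 * k)"
    using assms by (simp add: \<beta>_def powr_minus)
  then have "v (x, t) = C * (- t) powr (1 - s * q)" by (simp add: v_def)
  also have "\<dots> \<le> (K ^ (2 * k) + C) * (- t) powr (1 - s * q)"
    using K by (intro mult_right_mono) auto
  finally show ?thesis .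
qed

text \<open>The time derivative of the terms of \<open>\<phi>\<close> that do not depend on
  \<open>x\<close>.\<close>

definition "\<alpha>' \<epsilon> t0 t = - (C * (1 - s * q) * (- t) powr (- (s * q))) - \<epsilon> * (- t) powr (- 2) - 2 * (t - t0)"

text \<open>This is \<open>v - \<epsilon> / (- t)\<close> shifted by \<open>m\<close>; the last two powers make the touching at \<open>(x0, t0)\<close>
  strict without changing the derivatives that enter the equation there.\<close>

definition "\<phi> \<epsilon> m x0 t0 z = (K ^ (2 * k) + m + C * (- snd z) powr (1 - s * q) - \<epsilon> * (- snd z) powr (- 1) - (snd z - t0) ^ 2)
   - \<beta> (snd z) * (fst z \<bullet> fst z) ^ k - ((fst z - x0) \<bullet> (fst z - x0)) ^ k"
  for z :: "(real^'n) \<times> real"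

lemma C2_\<phi>: "C2_on (\<phi> \<epsilon> m x0 t0) \<Theta>"
proof -
  have neg: "C2_on (\<lambda>z :: (real^'n) \<times> real. - snd z) \<Theta>"
    by (intro C2_on_bounded_linear bounded_linear_minus bounded_linear_snd)
  have pos: "- snd z > 0" if "z \<in> \<Theta>" for z using that by (auto simp: \<Theta>)
  show ?thesis
    unfolding \<phi>_def[abs_def] \<beta>_def
    by (intro C2_on_minus C2_on_add C2_on_mult C2_on_const C2_on_powr[OF neg pos] C2_on_power
       C2_on_bounded_linear[OF bounded_linear_snd] C2_on_inner_fst C2_on_inner_fst[of 0, simplified])
qed

lemma \<beta>_derivative: "t < 0 \<Longrightarrow> (\<beta> has_real_derivative 2 * real k * s * (- t) powr (- (2 * real k * s) - 1)) (at t)"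
  unfolding \<beta>_def[abs_def] by (rule derivative_eq_intros has_real_derivative_powr_minus | simp)+

lemma \<alpha>_derivative:
  "t < 0 \<Longrightarrow> ((\<lambda>t. K ^ (2 * k) + m + C * (- t) powr (1 - s * q) - \<epsilon> * (- t) powr (- 1) - (t - t0) ^ 2)
     has_real_derivative \<alpha>' \<epsilon> t0 t) (at t)"
proof -
  assume t: "t < 0"
  have "((\<lambda>t. K ^ (2 * k) + m + C * (- t) powr (1 - s * q) - \<epsilon> * (- t) powr (- 1) - (t - t0) ^ 2)
     has_real_derivative 0 + 0 + C * ((1 - s * q) * (- t) powr (1 - s * q - 1) * (- 1))
        - \<epsilon> * ((- 1) * (- t) powr (- 1 - 1) * (- 1)) - 2 * (t - t0)) (at t)"
    by (rule has_real_derivative_powr_minus[OF t] derivative_eq_intros refl | simp)+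
  then show ?thesis by (simp add: \<alpha>'_def algebra_simps)
qed

text \<open>The \<open>\<epsilon>\<close> term pushes the time derivative strictly below
  \<open>- D\<close>, and the radial term only lowers it further. Off the axis \<open>Lpq\<close> is
  at least \<open>- D\<close>; on the axis the sign of the time derivative suffices.\<close>

lemma test_function_strict_subsolution:
  assumes "(x0, t0) \<in> \<Theta>" "\<epsilon> > 0"
  shows "admissible_at p q \<Theta> (\<phi> \<epsilon> m x0 t0) (x0, t0)"
    and "\<not> (if grad_x (\<phi> \<epsilon> m x0 t0) (x0, t0) \<noteq> 0
      then dt (\<phi> \<epsilon> m x0 t0) (x0, t0) - Lpq p q (\<phi> \<epsilon> m x0 t0) (x0, t0) \<ge> 0 else dt (\<phi> \<epsilon> m x0 t0) (x0, t0) \<ge> 0)"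
proof -
  let ?\<phi> = "\<phi> \<epsilon> m x0 t0"
  note kq = k
  have t0: "t0 < 0" and x0: "norm x0 < K * (- t0) powr s" using assms(1) by (auto simp: in_\<Theta>)
  define D where "D = C * (1 - s * q) * (- t0) powr (- (s * q))"
  have D: "D > 0" using C_pos sq t0 by (simp add: D_def)
  have \<alpha>'_less: "\<alpha>' \<epsilon> t0 t0 < - D"
    using assms(2) t0 by (simp add: \<alpha>'_def D_def)
  define \<kappa> where "\<kappa> = \<beta> t0"
  have \<kappa>: "\<kappa> > 0" using t0 by (simp add: \<kappa>_def \<beta>_def)
  define c where "c = K ^ (2 * k) + m + C * (- t0) powr (1 - s * q) - \<epsilon> * (- t0) powr (- 1)"
  interpret radial_profile "\<lambda>y. ?\<phi> (y, t0)" c \<kappa> 1 x0 k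
    by unfold_locales (use k in \<open>auto simp: \<phi>_def c_def \<kappa>_def fun_eq_iff\<close>)
  have "admissible_at p q \<Theta> ?\<phi> (x0, t0) \<and> \<not> (if grad_x ?\<phi> (x0, t0) \<noteq> 0
      then dt ?\<phi> (x0, t0) - Lpq p q ?\<phi> (x0, t0) \<ge> 0 else dt ?\<phi> (x0, t0) \<ge> 0)"
  proof (cases "x0 = 0")
    case True
    have "\<forall>\<^sub>F t in nhds t0. t < 0" using t0 by (simp add: eventually_nhds_in_open[of "{..<0}", simplified])
    then have \<alpha>: "\<forall>\<^sub>F t in nhds t0. ((\<lambda>t. K ^ (2 * k) + m + C * (- t) powr (1 - s * q) - \<epsilon> * (- t) powr (- 1) - (t - t0) ^ 2)
       has_real_derivative \<alpha>' \<epsilon> t0 t) (at t)"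
      by eventually_elim (rule \<alpha>_derivative)
    have "\<exists>D. (\<alpha>' \<epsilon> t0 has_real_derivative D) (at t0)"
      unfolding \<alpha>'_def[abs_def]
      by (rule exI) (rule has_real_derivative_powr_minus[OF t0] derivative_eq_intros refl)+
    then obtain \<alpha>'' where \<alpha>'': "(\<alpha>' \<epsilon> t0 has_real_derivative \<alpha>'') (at t0)" ..
    \<comment> \<open>For \<open>x0 = 0\<close> the power that makes the touching strict merges with
      the radial term, so its coefficient is \<open>\<beta> t + 1\<close>.\<close>
    have \<beta>1: "((\<lambda>t. \<beta> t + 1) has_real_derivative 2 * real k * s * (- t0) powr (- (2 * real k * s) - 1) + 0) (at t0)"
      by (intro derivative_intros \<beta>_derivative t0)
    have "admissible_at p q \<Theta> ?\<phi> (0, t0)" "dt ?\<phi> (0, t0) = \<alpha>' \<epsilon> t0 t0"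
      by (rule admissible_at_axis[OF open_\<Theta> _ kq \<alpha> \<alpha>'', of "\<lambda>t. \<beta> t + 1"];
        use assms(1) True DERIV_isCont[OF \<beta>1] in \<open>auto simp: \<phi>_def algebra_simps\<close>)+
    moreover have "grad_x ?\<phi> (x0, t0) = 0"
      using grad_profile True k by (simp add: grad_x_def)
    ultimately show ?thesis using \<alpha>'_less D True by simp
  next
    case False
    have gr: "grad_x ?\<phi> (x0, t0) \<noteq> 0"
      using grad_profile False \<kappa> k by (simp add: grad_x_def)
    have "((\<lambda>\<tau>. ?\<phi> (x0, \<tau>)) has_real_derivative \<alpha>' \<epsilon> t0 t0
       - 2 * real k * s * (- t0) powr (- (2 * real k * s) - 1) * (x0 \<bullet> x0) ^ k - 0) (at t0)"
      unfolding \<phi>_def fst_conv snd_conv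
      by (intro DERIV_diff DERIV_cmult_right \<alpha>_derivative \<beta>_derivative t0 DERIV_const)
    then have "dt ?\<phi> (x0, t0) = \<alpha>' \<epsilon> t0 t0
       - 2 * real k * s * (- t0) powr (- (2 * real k * s) - 1) * (x0 \<bullet> x0) ^ k"
      by (simp add: dt_def DERIV_imp_deriv)
    moreover have "2 * real k * s * (- t0) powr (- (2 * real k * s) - 1) * (x0 \<bullet> x0) ^ k \<ge> 0"
      using s by simp
    ultimately have "dt ?\<phi> (x0, t0) < - D" using \<alpha>'_less by linarith
    also have "- D \<le> Lpq p q ?\<phi> (x0, t0)"
    proof -
      have E: "E > 0" using kq by (simp add: E_def)
      have e: "(2 * real k * \<kappa>) * (2 * real k * \<kappa>) powr (q - 2) = (2 * real k * \<kappa>) powr (q - 1)"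
      proof -
        have "(2 * real k * \<kappa>) powr (q - 1) = (2 * real k * \<kappa>) powr (1 + (q - 2))" by simp
        also have "\<dots> = (2 * real k * \<kappa>) * (2 * real k * \<kappa>) powr (q - 2)"
          using k \<kappa> by (simp only: powr_add) simp
        finally show ?thesis ..
      qed
      have "- Lpq p q ?\<phi> (x0, t0) = (2 * real k * \<kappa>) * (2 * real k * \<kappa>) powr (q - 2) * N * norm x0 powr E"
        using Fpq_profile[OF False, of p q] \<kappa> by (simp add: Lpq_def grad_x_def hess_x_def N_def E_def)
      also have "\<dots> = (2 * real k * \<kappa>) powr (q - 1) * N * norm x0 powr E"
        by (simp only: e)
      \<comment> \<open>Since \<open>E > 0\<close>, the worst case is again the lateral
        wall.\<close>
      also have "\<dots> \<le> (2 * real k * \<kappa>) powr (q - 1) * N * (K * (- t0) powr s) powr E"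
        using x0 N_pos E by (intro mult_left_mono powr_mono2) auto
      also have "\<dots> = (2 * real k) powr (q - 1) * N * K powr E * ((- t0) powr (- (2 * real k * s) * (q - 1)) * (- t0) powr (s * E))"
        using t0 K by (simp add: \<kappa>_def \<beta>_def powr_mult powr_powr)
      \<comment> \<open>The contributions of \<open>k\<close> cancel, which leaves the exponent
        \<open>- (s * q)\<close> of \<open>D\<close>.\<close>
      also have "(- t0) powr (- (2 * real k * s) * (q - 1)) * (- t0) powr (s * E) = (- t0) powr (- (s * q))"
        unfolding powr_add[symmetric] by (rule arg_cong[where f = "\<lambda>e. (- t0) powr e"]) (simp add: E_def algebra_simps)
      also have "(2 * real k) powr (q - 1) * N * K powr E = C * (1 - s * q)"
        using sq by (simp add: C_def)
      finally show ?thesis by (simp add: D_def)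
    qed
    finally show ?thesis using gr by (auto simp: admissible_at_def)
  qed
  then show "admissible_at p q \<Theta> ?\<phi> (x0, t0)" "\<not> (if grad_x ?\<phi> (x0, t0) \<noteq> 0
      then dt ?\<phi> (x0, t0) - Lpq p q ?\<phi> (x0, t0) \<ge> 0 else dt ?\<phi> (x0, t0) \<ge> 0)"
    by blast+
qed

subsection \<open>Comparison and irregularity\<close>

definition "boundary_data z = (K ^ (2 * k) + C) * (- snd z) powr (1 - s * q)"
  for z :: "(real^'n) \<times> real"

text \<open>With \<open>m\<close> the minimum of \<open>u + \<epsilon> / (- t) - v\<close>, this
  form shows \<open>\<phi>\<close> below \<open>u\<close>, with equality only possible at
  \<open>(x0, t0)\<close>.\<close>

lemma \<phi>_eq: "\<phi> \<epsilon> m x0 t0 z = m - (\<epsilon> * (- snd z) powr (- 1) - v z) - (snd z - t0)\<^sup>2 - ((fst z - x0) \<bullet> (fst z - x0)) ^ k"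
  by (simp add: \<phi>_def v_def algebra_simps)

lemma isCont_v: "t < 0 \<Longrightarrow> isCont v (x, t)"
  unfolding v_def[abs_def] \<beta>_def[abs_def] by (auto intro!: continuous_intros)

lemma comparison:
  assumes u: "u \<in> upper_class p q \<Theta> boundary_data" and "\<xi>1 \<in> \<Theta>"
  shows "ereal (v \<xi>1) \<le> u \<xi>1"
proof (rule ccontr)
  assume neg: "\<not> ereal (v \<xi>1) \<le> u \<xi>1"
  have super: "viscosity_supersolution p q \<Theta> u"
    and u_bdry: "\<And>\<xi>. \<xi> \<in> frontier \<Theta> \<Longrightarrow> ereal (boundary_data \<xi>) \<le> Liminf (at \<xi> within \<Theta>) u"
    using u by (auto simp: upper_class_def)
  obtain c where c: "\<And>\<xi>. \<xi> \<in> \<Theta> \<Longrightarrow> ereal c \<le> u \<xi>"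
    using u by (auto simp: upper_class_def)
  have u_fin: "u \<xi> \<noteq> - \<infinity>" if "\<xi> \<in> \<Theta>" for \<xi> using c[OF that] by auto
  have u_lsc: "u \<xi> \<le> Liminf (at \<xi> within \<Theta>) u" if "\<xi> \<in> \<Theta>" for \<xi>
    using super that by (simp add: viscosity_supersolution_def)
  have neg_t: "snd z < 0" if "z \<in> \<Theta>" for z using that by (auto simp: \<Theta>)
  obtain r1 where r1: "u \<xi>1 = ereal r1" "r1 < v \<xi>1"
    using neg u_fin[OF assms(2)] by (cases "u \<xi>1") auto
  \<comment> \<open>At \<open>\<xi>1\<close> the penalty is half of the assumed gap
    \<open>v \<xi>1 - r1\<close>, so \<open>\<Phi> \<xi>1\<close> remains negative.\<close>
  define \<epsilon> where "\<epsilon> = (v \<xi>1 - r1) * (- snd \<xi>1) / 2"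
  have \<epsilon>: "\<epsilon> > 0" using r1(2) neg_t[OF assms(2)] by (auto simp: \<epsilon>_def intro!: mult_pos_neg)
  define h where "h z = \<epsilon> * (- snd z) powr (- 1) - v z" for z :: "(real^'n) \<times> real"
  define \<Phi> where "\<Phi> z = u z + ereal (h z)" for z
  \<comment> \<open>Truncation at 0 and extension by 0 give a function on the compact closure. It is
    lower semicontinuous because \<open>\<Phi>\<close> has nonnegative lower limits at the frontier,
    and a negative minimum of it is attained inside the horn.\<close>
  define g where "g z = (if z \<in> \<Theta> then min (\<Phi> z) 0 else 0)" for z
  have h_cont: "isCont h (x, t)" if "t < 0" for x t
    unfolding h_def[abs_def] using that by (auto intro!: continuous_intros isCont_v)
  have "h \<xi>1 = (v \<xi>1 - r1) / 2 - v \<xi>1"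
    using neg_t[OF assms(2)] by (simp add: h_def \<epsilon>_def powr_neg_one field_simps)
  then have \<Phi>1: "\<Phi> \<xi>1 < 0" using r1 by (simp add: \<Phi>_def field_simps)
  have lsc: "\<forall>\<^sub>F z in at \<xi> within closure \<Theta>. y < g z" if \<xi>: "\<xi> \<in> closure \<Theta>" and y: "y < g \<xi>" for \<xi> y
  proof (cases "\<xi> \<in> \<Theta>")
    case True
    have at: "at \<xi> within closure \<Theta> = at \<xi> within \<Theta>"
      using at_within_open_subset[OF True open_\<Theta>, of "closure \<Theta>"] at_within_open[OF True open_\<Theta>] closure_subset by metis
    have "y < u \<xi> + ereal (h \<xi>)" "y < 0" using y True by (auto simp: g_def \<Phi>_def)
    moreover have "isCont h \<xi>" using h_cont neg_t[OF True] by (metis prod.collapse)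
    then have "(h \<longlongrightarrow> h \<xi>) (at \<xi> within \<Theta>)"
      unfolding isCont_def by (rule tendsto_within_subset) simp
    ultimately have "\<forall>\<^sub>F z in at \<xi> within \<Theta>. y < \<Phi> z"
      unfolding \<Phi>_def using eventually_less_ereal_add[OF u_lsc[OF True] u_fin[OF True]] by blast
    then show ?thesis unfolding at by eventually_elim (use \<open>y < 0\<close> in \<open>simp add: g_def\<close>)
  next
    case False
    then have fr: "\<xi> \<in> frontier \<Theta>" and y0: "y < 0"
      using \<xi> y open_\<Theta> by (auto simp: frontier_def interior_open g_def)
    obtain x t where xt: "\<xi> = (x, t)" by force
    have "\<forall>\<^sub>F z in at \<xi> within \<Theta>. y < \<Phi> z"
    proof (cases "t < 0")
      case True
      \<comment> \<open>Away from the vertex \<open>h\<close> is continuous and \<open>u\<close> has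
        lower limits at least the datum, which dominates \<open>v\<close>.\<close>
      have "v \<xi> \<le> boundary_data \<xi>"
        using v_le_boundary[of x t] fr True by (simp add: xt boundary_data_def)
      moreover have "0 \<le> \<epsilon> * (- snd \<xi>) powr (- 1)" using \<epsilon> by simp
      ultimately have "0 \<le> boundary_data \<xi> + h \<xi>" unfolding h_def by linarith
      then have "0 \<le> ereal (boundary_data \<xi>) + ereal (h \<xi>)" by simp
      with y0 have "y < ereal (boundary_data \<xi>) + ereal (h \<xi>)" by (rule less_le_trans)
      moreover have "(h \<longlongrightarrow> h \<xi>) (at \<xi> within \<Theta>)"
        using h_cont[OF True, of x] unfolding isCont_def xt by (rule tendsto_within_subset) simp
      ultimately show ?thesis
        unfolding \<Phi>_def using eventually_less_ereal_add[OF u_bdry[OF fr]] by simp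
    next
      case False
      then have t: "t = 0" using frontier_\<Theta>(2)[of x t] fr by (simp add: xt)
      \<comment> \<open>Within time \<open>\<delta>\<close> of the vertex the penalty exceeds
        \<open>K ^ (2 * k) + C - c\<close>. With the bounds \<open>u \<ge> c\<close> and
        \<open>v \<le> K ^ (2 * k) + C\<close> this gives \<open>\<Phi> \<ge> 0\<close>; the summand
        1 keeps the denominator positive.\<close>
      define \<delta> where "\<delta> = \<epsilon> / (\<bar>K ^ (2 * k) + C - c\<bar> + 1)"
      have \<delta>: "\<delta> > 0" using \<epsilon> by (simp add: \<delta>_def add_nonneg_pos)
      have "((\<lambda>z. snd z) \<longlongrightarrow> 0) (at \<xi> within \<Theta>)" by (auto intro!: tendsto_eq_intros simp: xt t)
      then have "\<forall>\<^sub>F z in at \<xi> within \<Theta>. - \<delta> < snd z" using \<delta> by (intro order_tendstoD) auto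
      moreover have "\<forall>\<^sub>F z in at \<xi> within \<Theta>. z \<in> \<Theta>" by (simp add: eventually_at_filter)
      ultimately show ?thesis
      proof eventually_elim
        case (elim z)
        have z: "- 1 < snd z" "snd z < 0" using elim(2) by (auto simp: \<Theta>)
        have "\<bar>K ^ (2 * k) + C - c\<bar> + 1 = \<epsilon> / \<delta>" using \<epsilon> by (simp add: \<delta>_def)
        also have "\<dots> \<le> \<epsilon> / (- snd z)"
          using \<epsilon> \<delta> z elim(1) by (intro divide_left_mono) (auto intro: mult_pos_neg)
        also have "\<dots> = \<epsilon> * (- snd z) powr (- 1)"
          using z by (simp add: powr_neg_one)
        finally have "K ^ (2 * k) + C - c \<le> \<epsilon> * (- snd z) powr (- 1)" by linarith
        moreover have "v z \<le> K ^ (2 * k) + C" using v_le[of "snd z" "fst z"] z by simp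
        ultimately have "0 \<le> c + h z" unfolding h_def by linarith
        then have "0 \<le> ereal c + ereal (h z)" by simp
        also have "\<dots> \<le> \<Phi> z" unfolding \<Phi>_def by (intro add_right_mono c elim)
        finally show ?case using y0 by (rule less_le_trans[rotated])
      qed
    qed
    then have "\<forall>\<^sub>F z in nhds \<xi>. z \<noteq> \<xi> \<longrightarrow> z \<in> \<Theta> \<longrightarrow> y < \<Phi> z" by (simp add: eventually_at_filter)
    then show ?thesis
      unfolding eventually_at_filter by eventually_elim (use y0 in \<open>auto simp: g_def\<close>)
  qed
  have "\<xi>1 \<in> closure \<Theta>" using assms(2) closure_subset by blast
  then obtain \<xi>0 where \<xi>0: "\<xi>0 \<in> closure \<Theta>" "\<And>z. z \<in> closure \<Theta> \<Longrightarrow> g \<xi>0 \<le> g z"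
  proof -
    have "\<exists>x\<in>closure \<Theta>. \<forall>z\<in>closure \<Theta>. g x \<le> g z"
    proof (rule lsc_attains_inf[OF compact_closure_\<Theta>])
      show "closure \<Theta> \<noteq> {}" using assms(2) by (auto simp: closure_eq_empty)
    qed (rule lsc)
    with that show ?thesis by blast
  qed
  have "g \<xi>0 < 0"
    using \<xi>0(2)[OF \<open>\<xi>1 \<in> closure \<Theta>\<close>] \<Phi>1 assms(2) by (auto simp: g_def)
  then have in\<Theta>: "\<xi>0 \<in> \<Theta>" and \<Phi>0: "\<Phi> \<xi>0 < 0" "g \<xi>0 = \<Phi> \<xi>0"
    by (auto simp: g_def min_def split: if_splits)
  have \<Phi>_min: "\<Phi> \<xi>0 \<le> \<Phi> z" if "z \<in> \<Theta>" for z
    using \<xi>0(2)[of z] that closure_subset[of \<Theta>] \<Phi>0 by (auto simp: g_def)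
  obtain r where r: "u \<xi>0 = ereal r"
    using u_fin[OF in\<Theta>] \<Phi>0(1) by (cases "u \<xi>0") (auto simp: \<Phi>_def)
  obtain x0 t0 where xt: "\<xi>0 = (x0, t0)" by force
  \<comment> \<open>This is the minimum \<open>\<Phi> \<xi>0\<close> as a real number.\<close>
  define m where "m = r + h \<xi>0"
  let ?\<phi> = "\<phi> \<epsilon> m x0 t0"
  have "touches_below \<Theta> ?\<phi> u \<xi>0"
    unfolding touches_below_def
  proof
    show "ereal (?\<phi> \<xi>0) = u \<xi>0"
      unfolding r using k by (simp add: \<phi>_eq m_def h_def xt power_0_left)
    have "ereal (?\<phi> z) < u z" if z: "z \<in> \<Theta>" "z \<noteq> \<xi>0" for z
    proof -
      have "0 < (snd z - t0)\<^sup>2 + ((fst z - x0) \<bullet> (fst z - x0)) ^ k"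
      proof (cases "snd z = t0")
        case True
        then have "fst z \<noteq> x0" using z(2) xt by (metis prod.collapse)
        then show ?thesis by (simp add: add_nonneg_pos)
      qed (simp add: add_pos_nonneg)
      then have "?\<phi> z < m - h z" by (simp add: \<phi>_eq h_def)
      moreover have "ereal (m - h z) \<le> u z"
        using \<Phi>_min[OF z(1)] by (cases "u z") (auto simp: \<Phi>_def r m_def)
      ultimately show ?thesis by (metis ereal_less_le less_ereal.simps(1) less_le_trans)
    qed
    then show "\<forall>\<^sub>F z in at \<xi>0 within \<Theta>. ereal (?\<phi> z) < u z"
      by (auto simp: eventually_at_filter)
  qed
  then show False
    using viscosity_supersolutionD[OF super C2_\<phi> in\<Theta>] test_function_strict_subsolution[of x0 t0 \<epsilon> m] in\<Theta> \<epsilon>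
    unfolding xt by blast
qed

text \<open>Regularity would force the Perron solution to tend to 0 along the axis, because the data
  vanish at the vertex. By comparison it stays above \<open>v\<close>, hence above
  \<open>K ^ (2 * k)\<close>.\<close>

lemma vertex_not_regular: "\<not> regular_boundary_point p q \<Theta> (0, 0)"
proof
  assume "regular_boundary_point p q \<Theta> (0, 0)"
  moreover have "continuous_on (frontier \<Theta>) boundary_data"
    unfolding boundary_data_def[abs_def] using sq
    by (auto intro!: continuous_intros continuous_on_powr' dest: frontier_\<Theta>(2))
  ultimately have "(upper_Perron p q \<Theta> boundary_data \<longlongrightarrow> ereal (boundary_data (0, 0))) (at (0, 0) within \<Theta>)"
    unfolding regular_boundary_point_def by blast
  then have lim: "((\<lambda>t. upper_Perron p q \<Theta> boundary_data (0, t)) \<longlongrightarrow> 0) (at_left 0)"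
    using filterlim_compose[OF _ tendsto_axis] by (force simp: boundary_data_def zero_ereal_def)
  have "\<forall>\<^sub>F t in at_left (0::real). t \<in> {- 1<..<0}"
    by (rule eventually_at_left_real) simp
  then have "\<forall>\<^sub>F t in at_left (0::real). ereal (K ^ (2 * k)) \<le> upper_Perron p q \<Theta> boundary_data (0, t)"
  proof eventually_elim
    case (elim t)
    have "K ^ (2 * k) \<le> v (0, t)" using C_pos k by (simp add: v_def power_0_left)
    moreover have "ereal (v (0, t)) \<le> upper_Perron p q \<Theta> boundary_data (0, t)"
      unfolding upper_Perron_def using elim by (intro INF_greatest comparison axis_in_\<Theta>) auto
    ultimately show ?case by (meson ereal_less_eq(3) order_trans)
  qed
  with lim have "ereal (K ^ (2 * k)) \<le> 0"
    by (rule tendsto_lowerbound) simp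
  moreover have "K ^ (2 * k) > 0" using K by simp
  ultimately show False by simp
qed

end

theorem theorem6p2:
  fixes p q K s :: real and \<Theta> :: "((real^'n) \<times> real) set"
  assumes "p > 1" and "1 < q" and "q < 2" and "K > 0" and "0 < s" and "s < 1 / q"
    and "\<Theta> = {(x, t). norm x < K * (- t) powr s \<and> - 1 < t \<and> t < 0}"
  shows "(\<exists>w. barrier p q \<Theta> (0, 0) w) \<and> \<not> regular_boundary_point p q \<Theta> (0, 0)"
proof -
  \<comment> \<open>The choice of \<open>k0\<close> yields \<open>(2 * k - 1) * (q - 1) > 1\<close>,
    and adding 2 ensures \<open>k \<ge> 2\<close>.\<close>
  obtain k0 :: nat where k0: "1 / (q - 1) < real k0" using reals_Archimedean2 by blast
  define k where "k = k0 + 2"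
  have "1 < real k0 * (q - 1)" using k0 assms by (simp add: divide_simps)
  also have "\<dots> \<le> (2 * real k - 1) * (q - 1)" using assms by (intro mult_right_mono) (auto simp: k_def)
  finally have k: "1 < (2 * real k - 1) * (q - 1)" .
  have "s * q < 1" using assms by (simp add: field_simps)
  then interpret horn_subsolution K s \<Theta> p q k
    by unfold_locales (use assms k in \<open>simp_all only: k_def le_add2\<close>)
  show ?thesis using barrier_exists[of p q] vertex_not_regular assms by blast
qed

end
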